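(* Let $\mathcal D\subset\mathbb R^d$ be a domain and let $\{T_n(\mathbf x)\}_{n\in\mathbb N}$ be a sequence of families of matrices in $\mathrm{GL}_k(\mathbb C)$ depending continuously on $\mathbf x\in\mathcal D$. Assume that this sequence converges, uniformly on every compact subset of $\mathcal D$, to a family of matrices $T(\mathbf x)\in M_k(\mathbb C)$. Suppose furthermore that for each $\mathbf x\in\mathcal D$ the matrix $T(\mathbf x)$ has exactly one eigenvalue $\lambda_{max}(\mathbf x)$ of maximal modulus and that this eigenvalue is simple; let $\hat{\mathbf u}_{max}(\mathbf x)\in\mathbb P^{k-1}$ be the class of a corresponding eigenvector $\mathbf u_{max}(\mathbf x)$. Then there is a continuous map $\hat{\mathbf w}:\mathcal D\to\mathbb P^{k-1}$ such that for every $\mathbf x\in\mathcal D$ the product $T_n(\mathbf x)T_{n-1}(\mathbf x)\cdots T_2(\mathbf x)T_1(\mathbf x)$, viewed as an automorphism of $\mathbb P^{k-1}$, converges pointwise as $n\to\infty$ to the transformation $\hat{\mathbf u}_{max}(\mathbf x)\hat{\mathbf w}^{t}(\mathbf x)$ on $\mathbb P^{k-1}\setminus\widehat{H(\mathbf x)}$, where $H(\mathbf x)=\{\mathbf v\in\mathbb C^k:\mathbf w(\mathbf x)^{t}\mathbf v=0\}$ and $\mathbf w(\mathbf x)$ is any representative of $\hat{\mathbf w}(\mathbf x)$.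
   Context: $\mathbb P^{k-1}$ is the complex projective space of lines in $\mathbb C^k$; for $\mathbf v\in\mathbb C^k\setminus\{0\}$, $\hat{\mathbf v}\in\mathbb P^{k-1}$ denotes its class, and for a linear subspace $H\subset\mathbb C^k$, $\widehat H\subset\mathbb P^{k-1}$ denotes the set of classes of its nonzero vectors. A nonzero matrix $T$ induces a map $\hat T:\mathbb P^{k-1}\setminus\widehat{\ker T}\to\mathbb P^{k-1}$, $\hat{\mathbf v}\mapsto\widehat{T\mathbf v}$. In particular the transformation $\hat{\mathbf u}_{max}(\mathbf x)\hat{\mathbf w}^t(\mathbf x)$ is the one induced by the rank-one matrix $\mathbf u_{max}(\mathbf x)\mathbf w(\mathbf x)^t$; it is defined on $\mathbb P^{k-1}\setminus\widehat{H(\mathbf x)}$ and sends every point there to $\hat{\mathbf u}_{max}(\mathbf x)$. *)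

theory Defs
  imports "HOL-Analysis.Analysis" "HOL-Computational_Algebra.Polynomial"
begin

subsection \<open>Complex projective space\<close>

lemma dim_line: "vec.dim (vec.span {v :: complex ^ 'k}) = 1" if "v \<noteq> 0"
proof -
  have "vec.independent {v}" using that by simp
  then show ?thesis by (simp add: vec.dim_span_eq_card_independent)
qed

text \<open>If \<open>'k\<close> has \<open>k\<close> elements, this is the space of lines in \<open>k\<close>-dimensional complex space.\<close>

typedef 'k proj = "{L :: (complex ^ 'k::finite) set. vec.subspace L \<and> vec.dim L = 1}"
proof
  have "axis undefined 1 \<noteq> (0 :: complex ^ 'k)" by simp
  then show "vec.span {axis undefined 1} \<in> {L :: (complex ^ 'k) set. vec.subspace L \<and> vec.dim L = 1}"
    by (simp only: mem_Collect_eq dim_line vec.subspace_span simp_thms)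
qed

text \<open>The class of a vector; only meaningful for nonzero vectors.\<close>

definition proj_class :: "complex ^ 'k::finite \<Rightarrow> 'k proj"
  where "proj_class v = Abs_proj (vec.span {v})"

definition proj_subset :: "(complex ^ 'k::finite) set \<Rightarrow> 'k proj set"
  where "proj_subset H = {proj_class v | v. v \<in> H \<and> v \<noteq> 0}"

text \<open>The quotient topology with respect to \<^const>\<open>proj_class\<close> on the nonzero vectors. As the
  nonzero vectors form an open set, openness of a preimage relative to it is plain openness.\<close>

instantiation proj :: (finite) topological_space
begin

definition open_proj :: "'a proj set \<Rightarrow> bool"
  where "open_proj U \<longleftrightarrow> open {v. v \<noteq> 0 \<and> proj_class v \<in> U}"

instance
proof
  have "{v :: complex ^ 'a. v \<noteq> 0 \<and> proj_class v \<in> UNIV} = - {0}" by auto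
  then show "open (UNIV :: 'a proj set)"
    unfolding open_proj_def by (metis open_Compl closed_singleton)
next
  fix S T :: "'a proj set"
  assume "open S" "open T"
  then have "open ({v. v \<noteq> 0 \<and> proj_class v \<in> S} \<inter> {v. v \<noteq> 0 \<and> proj_class v \<in> T})"
    unfolding open_proj_def by (rule open_Int)
  also have "{v. v \<noteq> 0 \<and> proj_class v \<in> S} \<inter> {v. v \<noteq> 0 \<and> proj_class v \<in> T} =
      {v. v \<noteq> 0 \<and> proj_class v \<in> S \<inter> T}" by blast
  finally show "open (S \<inter> T)"
    unfolding open_proj_def .
next
  fix K :: "'a proj set set"
  assume "\<forall>S\<in>K. open S"
  then have "open (\<Union>S\<in>K. {v. v \<noteq> 0 \<and> proj_class v \<in> S})"
    unfolding open_proj_def by (rule open_UN)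
  also have "(\<Union>S\<in>K. {v. v \<noteq> 0 \<and> proj_class v \<in> S}) = {v. v \<noteq> 0 \<and> proj_class v \<in> \<Union>K}"
    by blast
  finally show "open (\<Union>K)"
    unfolding open_proj_def .
qed

end

text \<open>The map induced by a matrix: a line is sent to its image. Only meaningful outside
  \<open>proj_subset {v. A *v v = 0}\<close>, where the image is again a line.\<close>

definition proj_map :: "complex ^ 'k ^ 'k \<Rightarrow> 'k::finite proj \<Rightarrow> 'k proj"
  where "proj_map A p = Abs_proj ((\<lambda>v. A *v v) ` Rep_proj p)"

lemma Rep_proj_class: "Rep_proj (proj_class v) = vec.span {v}" if "v \<noteq> 0"
  unfolding proj_class_def
  by (rule Abs_proj_inverse) (simp only: mem_Collect_eq dim_line[OF that] vec.subspace_span simp_thms)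

lemma proj_map_class: "proj_map A (proj_class v) = proj_class (A *v v)" if "v \<noteq> 0"
  unfolding proj_map_def Rep_proj_class[OF that]
  by (simp only: proj_class_def vec.span_image[symmetric] image_insert image_empty)

lemma proj_class_surj: "\<exists>v. v \<noteq> 0 \<and> p = proj_class v"
proof -
  have p: "vec.subspace (Rep_proj p)" "vec.dim (Rep_proj p) = 1"
    using Rep_proj[of p] by auto
  obtain B where B: "B \<subseteq> Rep_proj p" "vec.independent B" "Rep_proj p \<subseteq> vec.span B"
      "card B = vec.dim (Rep_proj p)"
    using vec.basis_exists by blast
  obtain v where v: "B = {v}"
    using B(4) p(2) card_1_singletonE by metis
  have "Rep_proj p = vec.span {v}"
    using B(1,3) p(1) v vec.span_minimal by blast
  moreover have "v \<noteq> 0" using B(2) v vec.dependent_zero by blast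
  ultimately show ?thesis
    by (metis Rep_proj_inverse proj_class_def)
qed

subsection \<open>Eigenvalues\<close>

definition eigenvector :: "complex ^ 'k ^ 'k \<Rightarrow> complex ^ 'k \<Rightarrow> complex \<Rightarrow> bool"
  where "eigenvector A v c \<longleftrightarrow> v \<noteq> 0 \<and> A *v v = c *s v"

definition eigenvalue :: "complex ^ 'k ^ 'k \<Rightarrow> complex \<Rightarrow> bool"
  where "eigenvalue A c \<longleftrightarrow> (\<exists>v. eigenvector A v c)"

definition charpoly :: "complex ^ 'k ^ 'k \<Rightarrow> complex poly"
  where "charpoly A = det (mat [:0, 1:] - (\<chi> i j. [:A $ i $ j:]))"

text \<open>Algebraic multiplicity one.\<close>

definition simple_eigenvalue :: "complex ^ 'k ^ 'k \<Rightarrow> complex \<Rightarrow> bool"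
  where "simple_eigenvalue A c \<longleftrightarrow> eigenvalue A c \<and> order c (charpoly A) = 1"

definition max_modulus_eigenvalue :: "complex ^ 'k ^ 'k \<Rightarrow> complex \<Rightarrow> bool"
  where "max_modulus_eigenvalue A c \<longleftrightarrow>
    eigenvalue A c \<and> (\<forall>d. eigenvalue A d \<longrightarrow> cmod d \<le> cmod c)"

subsection \<open>Products and rank-one matrices\<close>

text \<open>\<open>mat_prod T n = T n ** \<dots> ** T 2 ** T 1\<close>; the value \<open>T 0\<close> is not used.\<close>

primrec mat_prod :: "(nat \<Rightarrow> complex ^ 'k ^ 'k) \<Rightarrow> nat \<Rightarrow> complex ^ 'k ^ 'k"
  where
    "mat_prod T 0 = mat 1"
  | "mat_prod T (Suc n) = T (Suc n) ** mat_prod T n"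

text \<open>The matrix \<open>u w\<^sup>t\<close> and the hyperplane \<open>w\<^sup>t v = 0\<close>. The transpose involves no complex
  conjugation, so the inner product of the library is not the right pairing.\<close>

definition rank_one :: "complex ^ 'k \<Rightarrow> complex ^ 'k \<Rightarrow> complex ^ 'k ^ 'k"
  where "rank_one u w = (\<chi> i j. u $ i * w $ j)"

definition hyperplane :: "complex ^ 'k \<Rightarrow> (complex ^ 'k) set"
  where "hyperplane w = {v. (\<Sum>i\<in>UNIV. w $ i * v $ i) = 0}"

lemma rank_one_mult_vec: "rank_one u w *v v = (\<Sum>i\<in>UNIV. w $ i * v $ i) *s u"
  by (simp add: vec_eq_iff rank_one_def matrix_vector_mult_def sum_distrib_left mult_ac)

lemma proj_class_scale: "proj_class (c *s v) = proj_class v" if "c \<noteq> 0"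
  using vec.span_image_scale[of "{v}" "\<lambda>_. c"] that
  by (simp only: proj_class_def finite.emptyI finite.insertI image_insert image_empty simp_thms)

lemma proj_map_rank_one:
  assumes "p \<notin> proj_subset (hyperplane w)"
  shows "proj_map (rank_one u w) p = proj_class u"
proof -
  obtain v where v: "v \<noteq> 0" "p = proj_class v" using proj_class_surj by blast
  then have "(\<Sum>i\<in>UNIV. w $ i * v $ i) \<noteq> 0"
    using assms unfolding proj_subset_def hyperplane_def by blast
  then show ?thesis
    by (simp only: v proj_map_class rank_one_mult_vec proj_class_scale not_False_eq_True)
qed

end

(* The rows of T_n ... T_1 are covectors pushed backwards through the transposed matrices. Near x0,
   in the chart y . u = 1 around the dominant left eigenvector of T(x0), this backward motion is
   uniformly contracting for an adapted norm. So the backward images of a covector converge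
   uniformly near x0 to a continuous w, which is nonzero because finitely many remaining factors
   are invertible.
   Conversely, the limit covectors w_n pair with v_n = T_n ... T_1 v to scalars a_n with
   a_(n+1) = g_n a_n and g_n -> lam. If w . v is nonzero, then the component of v_n in the
   complementary invariant hyperplane grows more slowly than a_n and v_n / a_n -> u_max; if
   w . v = 0, then v_n is annihilated by w_n and cannot approach the direction of u_max. Hence the
   hyperplane of w(x) is exactly the set of vectors whose images do not converge to u_max(x), which
   makes the local constructions agree. *)

theory Submission
  imports Defs "HOL-Computational_Algebra.Fundamental_Theorem_Algebra"
begin

text \<open>Neither \<open>lam_max\<close> nor \<open>u_max\<close> is assumed continuous in
  \<open>x\<close>, so no chart can move with \<open>x\<close>. Near \<open>x0\<close> the
  contraction is therefore estimated in the splitting at \<open>x0\<close>, with constants uniform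
  in \<open>x\<close>, while convergence to \<open>u_max x\<close> is proved in a second splitting
  at \<open>x\<close> itself. The bridge is \<open>slice_eigenvector_pairing\<close>: for each fixed
  \<open>x\<close> near \<open>x0\<close>, the covectors of the chart at \<open>x0\<close> pair with
  \<open>u_max x\<close> by an amount bounded away from zero, so they can be renormalised for the
  splitting at \<open>x\<close>. Algebraic simplicity enters as the nonvanishing of the pairing of a
  left and a right eigenvector. It makes the kernel of \<open>l\<close> an invariant complement of
  \<open>u\<close> on which all eigenvalues have modulus below that of \<open>lam\<close>. Decay of
  powers there is obtained by removing linear factors from annihilating polynomials, in place of a
  Jordan form, and an adapted norm turns it into contraction in one step. The value
  \<open>lam = 0\<close> can occur only if the projective space is a point; that case is treated
  separately.\<close>

subsection \<open>The bilinear pairing\<close>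

definition bdot :: "'a::comm_semiring_1 ^ 'k \<Rightarrow> 'a ^ 'k \<Rightarrow> 'a"
  where "bdot w v = (\<Sum>i\<in>UNIV. w $ i * v $ i)"

lemma bdot_add_left: "bdot (x + y) v = bdot x v + bdot y v"
  by (simp add: bdot_def distrib_right sum.distrib)

lemma bdot_add_right: "bdot w (x + y) = bdot w x + bdot w y"
  by (simp add: bdot_def distrib_left sum.distrib)

lemma bdot_diff_left: "bdot (x - y) v = bdot x v - bdot y v" for v :: "'a::comm_ring_1 ^ 'k"
  by (simp add: bdot_def left_diff_distrib sum_subtractf)

lemma bdot_diff_right: "bdot w (x - y) = bdot w x - bdot w y" for w :: "'a::comm_ring_1 ^ 'k"
  by (simp add: bdot_def right_diff_distrib sum_subtractf)

lemma bdot_scale_left: "bdot (c *s x) v = c * bdot x v"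
  by (simp add: bdot_def sum_distrib_left mult_ac)

lemma bdot_scale_right: "bdot w (c *s x) = c * bdot w x"
  by (simp add: bdot_def sum_distrib_left mult_ac)

lemmas bdot_simps = bdot_add_left bdot_add_right bdot_diff_left bdot_diff_right
  bdot_scale_left bdot_scale_right

lemma bdot_commute: "bdot w v = bdot v w"
  by (simp add: bdot_def mult.commute)

lemma bdot_transpose: "bdot (transpose M *v w) v = bdot w (M *v v)"
proof -
  have "bdot (transpose M *v w) v = (\<Sum>i\<in>UNIV. \<Sum>j\<in>UNIV. w $ j * M $ j $ i * v $ i)"
    by (simp add: bdot_def matrix_vector_mult_def transpose_def sum_distrib_left sum_distrib_right mult_ac)
  also have "\<dots> = (\<Sum>j\<in>UNIV. \<Sum>i\<in>UNIV. w $ j * M $ j $ i * v $ i)"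
    by (rule sum.swap)
  also have "\<dots> = bdot w (M *v v)"
    by (simp add: bdot_def matrix_vector_mult_def sum_distrib_left mult_ac)
  finally show ?thesis .
qed

lemma bdot_zero [simp]: "bdot 0 v = 0" "bdot w 0 = 0"
  by (simp_all add: bdot_def)

lemma bdot_axis [simp]: "bdot w (axis i 1) = w $ i"
  by (simp add: bdot_def axis_def if_distrib cong: if_cong)

lemma hyperplane_eq: "hyperplane w = {v. bdot w v = 0}"
  by (simp add: hyperplane_def bdot_def)

lemma norm_bdot_le: "norm (bdot w v) \<le> norm w * norm v" for w v :: "complex ^ 'k"
proof -
  have "norm (bdot w v) \<le> (\<Sum>i\<in>UNIV. \<bar>norm (w $ i)\<bar> * \<bar>norm (v $ i)\<bar>)"
    unfolding bdot_def by (rule order_trans[OF norm_sum]) (simp add: norm_mult)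
  also have "\<dots> \<le> norm w * norm v"
    unfolding norm_vec_def by (rule L2_set_mult_ineq)
  finally show ?thesis .
qed

text \<open>The norm of this matrix type is the Frobenius norm: Cauchy-Schwarz in each row bounds
  the operator norm by it.\<close>

lemma norm_matrix_vector_mult_le: "norm (A *v v) \<le> norm A * norm v" for A :: "complex ^ 'k ^ 'm"
proof -
  have "norm ((A *v v) $ i) \<le> norm (A $ i) * norm v" for i
    using norm_bdot_le[of "A $ i" v] by (simp add: bdot_def matrix_vector_mult_def)
  then have "norm (A *v v) \<le> L2_set (\<lambda>i. norm (A $ i) * norm v) UNIV"
    unfolding norm_vec_def[of "A *v v"] by (intro L2_set_mono) auto
  also have "\<dots> = norm A * norm v"
    by (simp add: norm_vec_def[of A] L2_set_left_distrib)
  finally show ?thesis .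
qed

lemma norm_transpose: "norm (transpose A) = norm A" for A :: "complex ^ 'k ^ 'm"
proof -
  have "(norm (transpose A))\<^sup>2 = (\<Sum>i\<in>UNIV. \<Sum>j\<in>UNIV. (norm (A $ j $ i))\<^sup>2)"
    by (simp add: norm_vec_def L2_set_def transpose_def sum_nonneg)
  also have "\<dots> = (norm A)\<^sup>2"
    by (subst sum.swap) (simp add: norm_vec_def L2_set_def sum_nonneg)
  finally show ?thesis by simp
qed

lemma norm_vector_scale: "norm (c *s v) = norm c * norm v" for v :: "complex ^ 'k"
  by (simp add: norm_vec_def norm_mult L2_set_right_distrib)

lemma matrix_vector_scale: "A *v (c *s v) = c *s (A *v v)" for A :: "'a::comm_semiring_1 ^ 'k ^ 'm"
  by (simp add: vec_eq_iff matrix_vector_mult_def sum_distrib_left mult_ac)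

lemma transpose_diff: "transpose (A - B) = transpose A - transpose B"
  by (simp add: transpose_def vec_eq_iff)

subsection \<open>Simple eigenvalues\<close>

lemma eigenvalue_iff_det: "eigenvalue A c \<longleftrightarrow> det (mat c - A) = 0"
proof -
  have "mat c *v v = c *s v" for v :: "complex ^ 'a"
    by (simp add: vec_eq_iff matrix_vector_mult_def mat_def if_distrib if_distribR cong: if_cong)
  then have "(mat c - A) *v v = c *s v - A *v v" for v
    by (simp add: matrix_vector_mult_diff_rdistrib)
  then have "eigenvalue A c \<longleftrightarrow> (\<exists>v. (mat c - A) *v v = 0 \<and> v \<noteq> 0)"
    unfolding eigenvalue_def eigenvector_def by (metis eq_iff_diff_eq_0)
  also have "\<dots> \<longleftrightarrow> \<not> invertible (mat c - A)"
    using matrix_left_invertible_ker[of "mat c - A"] by (auto simp: invertible_left_inverse)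
  finally show ?thesis by (simp add: invertible_det_nz)
qed

lemma eigenvalue_transpose: "eigenvalue (transpose A) c \<longleftrightarrow> eigenvalue A c"
proof -
  have "mat c - transpose A = transpose (mat c - A)"
    by (simp add: transpose_diff)
  then show ?thesis by (simp only: eigenvalue_iff_det det_transpose)
qed

lemma poly_det: "poly (det P) t = det (\<chi> i j. poly (P $ i $ j) t)"
  for P :: "complex poly ^ 'k ^ 'k"
  by (simp add: det_def poly_sum poly_prod)

text \<open>A number of modulus above \<open>norm A\<close> is not an eigenvalue, so the polynomial
  does not vanish there.\<close>

lemma charpoly_nonzero: "charpoly A \<noteq> 0"
proof
  assume 0: "charpoly A = 0"
  define t where "t = complex_of_real (norm A + 1)"
  have t: "norm t = norm A + 1" using norm_ge_zero[of A] unfolding t_def norm_of_real by linarith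
  have "(\<chi> i j. poly ((mat [:0, 1:] - (\<chi> i j. [:A $ i $ j:])) $ i $ j) t) = mat t - A"
    by (simp add: vec_eq_iff mat_def)
  then have "det (mat t - A) = 0"
    using 0 poly_det[of "mat [:0, 1:] - (\<chi> i j. [:A $ i $ j:])" t] by (simp add: charpoly_def)
  then obtain v where v: "v \<noteq> 0" "A *v v = t *s v"
    unfolding eigenvalue_iff_det[symmetric] eigenvalue_def eigenvector_def by blast
  have "norm t * norm v \<le> norm A * norm v"
    using norm_matrix_vector_mult_le[of A v] by (simp add: v norm_vector_scale)
  then have "(norm A + 1) * norm v \<le> norm A * norm v" by (simp only: t)
  then have "norm v \<le> 0" by (simp add: distrib_right)
  with v(1) show False by simp
qed

lemma sum_mult_mat: "(\<Sum>k\<in>UNIV. f k * mat c $ k $ b) = f b * c"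
  for f :: "'k::finite \<Rightarrow> 'a::comm_semiring_1"
  by (simp add: mat_def if_distrib[of "\<lambda>x. _ * x"] cong: if_cong)

lemma sum_mat_mult: "(\<Sum>k\<in>UNIV. mat c $ a $ k * f k) = c * f a"
  for f :: "'k::finite \<Rightarrow> 'a::comm_semiring_1"
  by (simp add: mat_def if_distrib[of "\<lambda>x. x * _"] cong: if_cong)

text \<open>Replacing a suitable row by \<open>l\<close> and a suitable column by \<open>u\<close> makes that row and that column
  of \<open>X - A\<close> multiples of \<open>X - c\<close>. If \<open>bdot l u = 0\<close>, then their common entry vanishes, so
  \<open>(X - c)\<^sup>2\<close> divides the characteristic polynomial.\<close>

lemma simple_eigenvalue_bdot_nonzero:
  fixes A :: "complex ^ 'k ^ 'k"
  assumes simple: "order c (charpoly A) = 1"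
    and u: "A *v u = c *s u" "u \<noteq> 0"
    and l: "transpose A *v l = c *s l" "l \<noteq> 0"
  shows "bdot l u \<noteq> 0"
proof
  assume lu: "bdot l u = 0"
  obtain i where i: "l $ i \<noteq> 0" using l(2) unfolding vec_eq_iff by auto
  obtain j where j: "u $ j \<noteq> 0" using u(2) unfolding vec_eq_iff by auto
  define x where "x = [:-c, 1:]"
  define N where "N = mat [:0, 1:] - (\<chi> i j. [:A $ i $ j:])"
  \<comment> \<open>The identity matrix with row \<open>k\<close> replaced by \<open>v\<close>. It
    is invertible if \<open>v $ k\<close> is nonzero: the other rows kill all other coordinates of a
    kernel vector, then row \<open>k\<close> kills the last one.\<close>
  define R :: "'k \<Rightarrow> complex ^ 'k \<Rightarrow> complex ^ 'k ^ 'k"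
    where "R k v = (\<chi> a b. if a = k then v $ b else mat 1 $ a $ b)" for k v
  have det_R: "det (R k v) \<noteq> 0" if "v $ k \<noteq> 0" for k v
  proof -
    have "y = 0" if y: "R k v *v y = 0" for y
    proof -
      have y0: "y $ a = 0" if "a \<noteq> k" for a
      proof -
        have "(R k v *v y) $ a = (\<Sum>b\<in>UNIV. mat 1 $ a $ b * y $ b)"
          using that by (simp add: R_def matrix_vector_mult_def)
        then show ?thesis using y by (simp add: sum_mat_mult)
      qed
      from y0 have "v $ k * y $ k = 0"
        using arg_cong[OF y, of "\<lambda>y. y $ k"] sum.remove[of UNIV k "\<lambda>b. v $ b * y $ b"]
        by (simp add: R_def matrix_vector_mult_def)
      then have "y $ a = 0" for a
        using y0[of a] \<open>v $ k \<noteq> 0\<close> by (cases "a = k") auto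
      then show "y = 0" by (simp add: vec_eq_iff)
    qed
    then show ?thesis
      by (simp add: invertible_det_nz[symmetric] invertible_left_inverse matrix_left_invertible_ker)
  qed
  \<comment> \<open>Multiplying by \<open>Y\<close> on the left replaces row \<open>i\<close> of the
    matrix by its combination with coefficients \<open>l\<close>; multiplying by \<open>Z\<close> on
    the right replaces column \<open>j\<close> by its combination with coefficients
    \<open>u\<close>.\<close>
  define Y where "Y = R i l"
  define Z where "Z = transpose (R j u)"
  have YZ: "det Y \<noteq> 0" "det Z \<noteq> 0"
    using det_R i j by (auto simp: Y_def Z_def)
  define P where "P B = (\<chi> a b. [:B $ a $ b:])" for B :: "complex ^ 'k ^ 'k"
  have order_P: "order c (det (P B)) = 0" "det (P B) \<noteq> 0" if "det B \<noteq> 0" for B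
  proof -
    have "poly (det (P B)) c = det B" by (simp add: poly_det P_def)
    then show "order c (det (P B)) = 0" "det (P B) \<noteq> 0"
      using that order_0I[of "det (P B)" c] by auto
  qed
  define D :: "'k \<Rightarrow> complex poly ^ 'k ^ 'k"
    where "D k = (\<chi> a b. (if a = k then x else 1) * mat 1 $ a $ b)" for k
  have det_D: "det (D k) = x" for k
    by (subst det_diagonal) (auto simp: D_def mat_def)
  \<comment> \<open>What remains after taking one factor \<open>x\<close> out of row
    \<open>i\<close> and one out of column \<open>j\<close>. The entry \<open>(i, j)\<close> would
    have to supply both factors but carries only one; it is \<open>x * bdot l u\<close>, which is
    zero.\<close>
  define G where "G = (\<chi> a b. if a = i then if b = j then 0 else [:l $ b:]
    else if b = j then [:u $ a:] else N $ a $ b)"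
  have PY: "(P Y ** N) $ a $ b = (if a = i then x * [:l $ b:] else N $ a $ b)" for a b
  proof -
    have "(\<Sum>k\<in>UNIV. [:l $ k:] * N $ k $ b) = x * [:l $ b:]"
    proof -
      have "(\<Sum>k\<in>UNIV. A $ k $ b * l $ k) = c * l $ b"
        using arg_cong[OF l(1), of "\<lambda>y. y $ b"]
        by (simp add: matrix_vector_mult_def transpose_def)
      then have "(\<Sum>k\<in>UNIV. [:l $ k:] * [:A $ k $ b:]) = [:c * l $ b:]"
        by (simp add: sum_to_poly mult.commute)
      moreover have "(\<Sum>k\<in>UNIV. [:l $ k:] * N $ k $ b) =
          [:l $ b:] * [:0, 1:] - (\<Sum>k\<in>UNIV. [:l $ k:] * [:A $ k $ b:])"
        by (simp only: N_def vector_minus_component vec_lambda_beta right_diff_distrib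
            sum_subtractf sum_mult_mat)
      ultimately show ?thesis by (simp add: x_def mult.commute)
    qed
    moreover have "(P Y ** N) $ a $ b = (\<Sum>k\<in>UNIV. mat 1 $ a $ k * N $ k $ b)" if "a \<noteq> i"
      unfolding matrix_matrix_mult_def vec_lambda_beta
      by (intro sum.cong) (use that in \<open>auto simp: P_def Y_def R_def mat_def\<close>)
    then have "(P Y ** N) $ a $ b = N $ a $ b" if "a \<noteq> i"
      using that by (simp add: sum_mat_mult)
    moreover have "(P Y ** N) $ i $ b = (\<Sum>k\<in>UNIV. [:l $ k:] * N $ k $ b)"
      by (simp add: matrix_matrix_mult_def P_def Y_def R_def)
    ultimately show ?thesis by auto
  qed
  have Nu: "(\<Sum>k\<in>UNIV. N $ a $ k * [:u $ k:]) = x * [:u $ a:]" for a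
  proof -
    have "(\<Sum>k\<in>UNIV. A $ a $ k * u $ k) = c * u $ a"
      using arg_cong[OF u(1), of "\<lambda>y. y $ a"] by (simp add: matrix_vector_mult_def)
    then have "(\<Sum>k\<in>UNIV. [:A $ a $ k:] * [:u $ k:]) = [:c * u $ a:]"
      by (simp add: sum_to_poly mult.commute)
    moreover have "(\<Sum>k\<in>UNIV. N $ a $ k * [:u $ k:]) =
        [:0, 1:] * [:u $ a:] - (\<Sum>k\<in>UNIV. [:A $ a $ k:] * [:u $ k:])"
      by (simp only: N_def vector_minus_component vec_lambda_beta left_diff_distrib
          sum_subtractf sum_mat_mult)
    ultimately show ?thesis by (simp add: x_def mult.commute)
  qed
  have lu': "(\<Sum>k\<in>UNIV. x * [:l $ k:] * [:u $ k:]) = 0"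
  proof -
    have "(\<Sum>k\<in>UNIV. x * [:l $ k:] * [:u $ k:]) = x * (\<Sum>k\<in>UNIV. [:l $ k:] * [:u $ k:])"
      by (simp add: sum_distrib_left mult.assoc)
    also have "(\<Sum>k\<in>UNIV. [:l $ k:] * [:u $ k:]) = 0"
      using lu by (simp add: bdot_def sum_to_poly mult.commute)
    finally show ?thesis by simp
  qed
  have "(P Y ** N ** P Z) $ a $ b = (D i ** G ** D j) $ a $ b" for a b
  proof -
    have "(P Y ** N ** P Z) $ a $ b = (\<Sum>k\<in>UNIV. (P Y ** N) $ a $ k *
        (if b = j then [:u $ k:] else mat 1 $ k $ b))"
      unfolding matrix_matrix_mult_def[of "P Y ** N"] vec_lambda_beta
      by (intro sum.cong) (auto simp: P_def Z_def R_def transpose_def mat_def)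
    also have "\<dots> = (if b = j then \<Sum>k\<in>UNIV. (P Y ** N) $ a $ k * [:u $ k:]
        else (P Y ** N) $ a $ b)"
      by (simp add: sum_mult_mat)
    also have "\<dots> = (if a = i then x else 1) * (if b = j then x else 1) * G $ a $ b"
      using lu' Nu[of a] by (simp add: PY G_def)
    also have "\<dots> = (D i ** G ** D j) $ a $ b"
    proof -
      have "(D i ** G) $ a $ k = (if a = i then x else 1) * G $ a $ k" for k
        by (simp only: D_def matrix_matrix_mult_def vec_lambda_beta mult.assoc
            sum_distrib_left[symmetric] sum_mat_mult mult_1_left)
      moreover have "(D i ** G ** D j) $ a $ b = (D i ** G) $ a $ b * (if b = j then x else 1)"
        by (simp only: D_def[of j] matrix_matrix_mult_def[of "D i ** G"] vec_lambda_beta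
            mult.assoc[symmetric] sum_mult_mat mult_1_right)
      ultimately show ?thesis by (simp only: mult_ac)
    qed
    finally show ?thesis .
  qed
  then have "P Y ** N ** P Z = D i ** G ** D j"
    by (simp add: vec_eq_iff)
  then have "det (P Y ** N ** P Z) = x * det G * x"
    by (simp add: det_mul det_D)
  \<comment> \<open>The constant matrices have nonzero determinants, hence order 0 at
    \<open>c\<close>, so the two factors \<open>x\<close> must both come from the characteristic
    polynomial.\<close>
  then have eq: "det (P Y) * charpoly A * det (P Z) = x ^ 2 * det G"
    by (simp add: det_mul charpoly_def N_def power2_eq_square mult_ac)
  then have "x ^ 2 dvd det (P Y) * charpoly A * det (P Z)" by simp
  moreover have nz: "det (P Y) * charpoly A * det (P Z) \<noteq> 0"
    using order_P(2) YZ charpoly_nonzero by simp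
  ultimately have "2 \<le> order c (det (P Y) * charpoly A * det (P Z))"
    by (simp add: order_divides x_def)
  also have "\<dots> = 1"
    using nz order_P(1) YZ simple by (simp add: order_mult)
  finally show False by simp
qed

subsection \<open>Powers of a matrix on an invariant subspace\<close>

text \<open>This is p(A) v.\<close>

definition poly_act :: "complex ^ 'k ^ 'k \<Rightarrow> complex poly \<Rightarrow> complex ^ 'k \<Rightarrow> complex ^ 'k"
  where "poly_act A p v = (\<Sum>i\<le>degree p. coeff p i *s (((*v) A) ^^ i) v)"

lemma poly_act_altdef:
  assumes "degree p \<le> n"
  shows "poly_act A p v = (\<Sum>i\<le>n. coeff p i *s (((*v) A) ^^ i) v)"
  unfolding poly_act_def
  by (rule sum.mono_neutral_left) (use assms in \<open>auto simp: coeff_eq_0\<close>)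

lemma poly_act_linear_factor:
  "poly_act A ([:-c, 1:] * g) v = A *v poly_act A g v - c *s poly_act A g v"
proof -
  define n where "n = degree g"
  have n: "degree ([:-c, 1:] * g) \<le> Suc n" "degree g \<le> Suc n"
    unfolding n_def using degree_mult_le[of "[:-c, 1:]" g] by auto
  have "poly_act A ([:-c, 1:] * g) v =
      (\<Sum>i\<le>Suc n. (coeff (pCons 0 g) i - c * coeff g i) *s (((*v) A) ^^ i) v)"
    unfolding poly_act_altdef[OF n(1)] by (intro sum.cong) auto
  also have "\<dots> = (\<Sum>i\<le>Suc n. coeff (pCons 0 g) i *s (((*v) A) ^^ i) v) - c *s poly_act A g v"
    unfolding poly_act_altdef[OF n(2)]
    by (simp only: vec.scale_left_diff_distrib sum_subtractf vec.scale_sum_right vec.scale_scale)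
  also have "(\<Sum>i\<le>Suc n. coeff (pCons 0 g) i *s (((*v) A) ^^ i) v) =
      (\<Sum>i\<le>n. A *v (coeff g i *s (((*v) A) ^^ i) v))"
    by (simp add: sum.atMost_Suc_shift matrix_vector_scale del: sum.atMost_Suc)
  also have "\<dots> = A *v poly_act A g v"
    by (simp only: poly_act_def n_def vec.linear_sum[OF matrix_vector_mul_linear_gen])
  finally show ?thesis .
qed

lemma funpow_matrix_diff: "(((*v) A) ^^ n) (x - y) = (((*v) A) ^^ n) x - (((*v) A) ^^ n) y"
  for A :: "'a::ring_1 ^ 'k ^ 'k"
  by (induction n) (simp_all add: matrix_vector_mult_diff_distrib)

lemma funpow_matrix_add: "(((*v) A) ^^ n) (x + y) = (((*v) A) ^^ n) x + (((*v) A) ^^ n) y"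
  for A :: "'a::semiring_1 ^ 'k ^ 'k"
  by (induction n) (simp_all add: matrix_vector_right_distrib)

lemma funpow_matrix_scale: "(((*v) A) ^^ n) (c *s x) = c *s (((*v) A) ^^ n) x"
  for A :: "'a::comm_semiring_1 ^ 'k ^ 'k"
  by (induction n) (simp_all add: matrix_vector_scale)

lemma poly_act_commute:
  "poly_act A g (A *v v - c *s v) = A *v poly_act A g v - c *s poly_act A g v"
proof -
  have "(((*v) A) ^^ i) (A *v v - c *s v) = A *v (((*v) A) ^^ i) v - c *s (((*v) A) ^^ i) v" for i
    by (simp add: funpow_matrix_diff funpow_matrix_scale funpow_swap1)
  then show ?thesis
    by (simp add: poly_act_def vec.linear_sum[OF matrix_vector_mul_linear_gen] vec.scale_sum_right
        matrix_vector_scale vec.scale_right_diff_distrib sum_subtractf mult.commute)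
qed

lemma poly_act_mem:
  assumes V: "vec.subspace V" "\<And>v. v \<in> V \<Longrightarrow> A *v v \<in> V" and v: "v \<in> V"
  shows "poly_act A g v \<in> V"
proof -
  have "(((*v) A) ^^ i) v \<in> V" for i
    using v V(2) by (induction i) auto
  then show ?thesis
    unfolding poly_act_def using V(1) by (intro vec.subspace_sum vec.subspace_scale)
qed

text \<open>The first k+1 iterates of \<open>v\<close> are linearly dependent. Dependence concerns
  sets, so coinciding iterates are a case of their own, with a difference of two monomials as
  annihilator.\<close>

lemma annihilating_poly_exists: "\<exists>p. p \<noteq> 0 \<and> poly_act A p v = 0"
proof -
  define f where "f i = (((*v) A) ^^ i) v" for i
  show ?thesis
  proof (cases "inj_on f {..CARD('a)}")
    case True
    define S where "S = f ` {..CARD('a)}"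
    have S: "finite S" "card S = Suc (CARD('a))"
      using True by (simp_all add: S_def card_image)
    have "vec.dim S \<le> CARD('a)"
      by (rule dim_subset_UNIV_cart_gen)
    then have "vec.dependent S"
      using S by (intro vec.dependent_biggerset_general) auto
    then obtain u where u: "\<exists>y\<in>S. u y \<noteq> 0" "(\<Sum>y\<in>S. u y *s y) = 0"
      using S(1) vec.dependent_finite by blast
    define p where "p = (\<Sum>i\<le>CARD('a). monom (u (f i)) i)"
    have c: "coeff p i = (if i \<le> CARD('a) then u (f i) else 0)" for i
      by (simp add: p_def coeff_sum)
    then have "degree p \<le> CARD('a)"
      by (intro degree_le) auto
    then have "poly_act A p v = (\<Sum>i\<le>CARD('a). u (f i) *s f i)"
      by (simp add: poly_act_altdef c f_def)
    also have "\<dots> = 0"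
      using u(2) by (simp add: S_def sum.reindex[OF True])
    finally have "poly_act A p v = 0" .
    moreover have "p \<noteq> 0"
    proof -
      obtain i where "i \<le> CARD('a)" "u (f i) \<noteq> 0"
        using u(1) by (auto simp: S_def)
      then have "coeff p i \<noteq> 0" by (simp add: c)
      then show ?thesis by auto
    qed
    ultimately show ?thesis by blast
  next
    case False
    then obtain i j where ij: "i \<noteq> j" "f i = f j" by (auto simp: inj_on_def)
    define p :: "complex poly" where "p = monom 1 i - monom 1 j"
    have "degree p \<le> max i j"
      unfolding p_def by (intro degree_diff_le) (auto simp: degree_monom_eq)
    then have "poly_act A p v = (\<Sum>m\<le>max i j. (if m = i then f m else 0) - (if m = j then f m else 0))"
      unfolding poly_act_altdef[OF \<open>degree p \<le> max i j\<close>]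
      by (intro sum.cong) (auto simp: p_def f_def)
    also have "\<dots> = 0"
      using ij by (simp add: sum_subtractf)
    finally have "poly_act A p v = 0" .
    moreover have "coeff p i = 1" using ij by (simp add: p_def)
    then have "p \<noteq> 0" by auto
    ultimately show ?thesis by blast
  qed
qed

text \<open>Split an annihilating polynomial of \<open>v\<close> into linear factors. Factors \<open>A - c\<close> that are
  injective on \<open>V\<close> can be dropped; for the others \<open>c\<close> has an eigenvector in \<open>V\<close>.\<close>

lemma invariant_subspace_induct:
  fixes A :: "complex ^ 'k ^ 'k"
  assumes V: "vec.subspace V" "\<And>v. v \<in> V \<Longrightarrow> A *v v \<in> V" and v: "v \<in> V"
    and zero: "Q 0"
    and step: "\<And>v z c. v \<in> V \<Longrightarrow> z \<in> V \<Longrightarrow> eigenvector A z c \<Longrightarrow> Q (A *v v - c *s v) \<Longrightarrow> Q v"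
  shows "Q v"
proof -
  obtain p where "p \<noteq> 0" "poly_act A p v = 0"
    using annihilating_poly_exists by blast
  then show ?thesis using v
  proof (induction "degree p" arbitrary: p v)
    case 0
    then obtain a where "p = [:a:]" "a \<noteq> 0"
      by (metis degree_eq_zeroE pCons_0_0)
    with 0 zero show ?case by (simp add: poly_act_def)
  next
    case (Suc n)
    have "\<not> constant (poly p)"
      using Suc.hyps(2) by (simp add: constant_degree)
    then obtain c where "poly p c = 0"
      using fundamental_theorem_of_algebra by blast
    then obtain g where g: "p = [:-c, 1:] * g"
      by (auto simp: poly_eq_0_iff_dvd)
    with Suc.prems have "g \<noteq> 0" by auto
    then have "degree p = 1 + degree g"
      unfolding g by (subst degree_mult_eq) auto
    with Suc.hyps(2) have dg: "n = degree g" by simp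
    \<comment> \<open>\<open>A - c\<close> annihilates \<open>z\<close>. If \<open>z = 0\<close>,
      then \<open>g\<close> already annihilates \<open>v\<close>; otherwise \<open>z\<close> is an
      eigenvector in \<open>V\<close> and \<open>g\<close> annihilates
      \<open>A *v v - c *s v\<close>. Either way the degree drops.\<close>
    define z where "z = poly_act A g v"
    have z: "z \<in> V" unfolding z_def by (rule poly_act_mem) (use V Suc.prems(3) in auto)
    have Az: "A *v z = c *s z"
      using Suc.prems(2) unfolding g poly_act_linear_factor z_def by simp
    show ?case
    proof (cases "z = 0")
      case True
      then show ?thesis using Suc.hyps(1)[OF dg] \<open>g \<noteq> 0\<close> Suc.prems(3) by (simp add: z_def)
    next
      case False
      have "poly_act A g (A *v v - c *s v) = 0"
        using Az by (simp add: poly_act_commute z_def)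
      moreover have "A *v v - c *s v \<in> V"
        using V Suc.prems(3) by (intro vec.subspace_diff vec.subspace_scale)
      ultimately have "Q (A *v v - c *s v)"
        using Suc.hyps(1)[OF dg] \<open>g \<noteq> 0\<close> by blast
      then show ?thesis
        using step Suc.prems(3) z Az False by (auto simp: eigenvector_def)
    qed
  qed
qed

lemma contracting_recurrence_tendsto_zero:
  fixes a d :: "nat \<Rightarrow> real"
  assumes q: "0 \<le> q" "q < 1" and a: "\<And>n. 0 \<le> a n"
    and rec: "eventually (\<lambda>n. a (Suc n) \<le> q * a n + d n) sequentially" and d: "d \<longlonglongrightarrow> 0"
  shows "a \<longlonglongrightarrow> 0"
proof (rule tendstoI)
  fix e :: real assume e: "0 < e"
  \<comment> \<open>The threshold makes \<open>e / 2\<close> the fixed point of the affine map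
    \<open>t\<close> to \<open>q * t + e / 2 * (1 - q)\<close>, so iterating this map leaves an
    excess of at most \<open>q ^ n * a N\<close> over \<open>e / 2\<close>.\<close>
  then have "eventually (\<lambda>n. \<bar>d n\<bar> < e / 2 * (1 - q)) sequentially"
    using tendstoD[OF d, of "e / 2 * (1 - q)"] q by (simp add: dist_real_def)
  with rec have "eventually (\<lambda>n. a (Suc n) \<le> q * a n + e / 2 * (1 - q)) sequentially"
    by eventually_elim auto
  then obtain N where N: "\<And>n. n \<ge> N \<Longrightarrow> a (Suc n) \<le> q * a n + e / 2 * (1 - q)"
    by (auto simp: eventually_sequentially)
  have bound: "a (n + N) \<le> q ^ n * a N + e / 2" for n
  proof (induction n)
    case (Suc n)
    have "a (Suc n + N) \<le> q * (q ^ n * a N + e / 2) + e / 2 * (1 - q)"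
      using N[of "n + N"] mult_left_mono[OF Suc q(1)] by simp
    then show ?case by (simp add: algebra_simps diff_divide_distrib)
  qed (use e in simp)
  have "(\<lambda>n. q ^ n * a N) \<longlonglongrightarrow> 0 * a N"
    using q by (intro tendsto_intros LIMSEQ_realpow_zero) auto
  then have "eventually (\<lambda>n. q ^ n * a N < e / 2) sequentially"
    using e by (intro order_tendstoD(2)) auto
  then have "eventually (\<lambda>n. dist (a (n + N)) 0 < e) sequentially"
  proof eventually_elim
    case (elim n)
    then show ?case using bound[of n] a[of "n + N"] by (simp add: dist_real_def)
  qed
  then show "eventually (\<lambda>n. dist (a n) 0 < e) sequentially"
    by (rule eventually_sequentially_seg[THEN iffD1])
qed

text \<open>If the iterates of \<open>y = A *v v - c *s v\<close> decay, the normalised iterates of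
  \<open>v\<close> satisfy a recurrence with ratio \<open>norm c / r < 1\<close> and a null
  inhomogeneity. Repeated eigenvalues cause no polynomial factors to be tracked.\<close>

lemma funpow_decay:
  fixes A :: "complex ^ 'k ^ 'k"
  assumes V: "vec.subspace V" "\<And>v. v \<in> V \<Longrightarrow> A *v v \<in> V"
    and r: "0 < r" "\<And>z c. z \<in> V \<Longrightarrow> eigenvector A z c \<Longrightarrow> norm c < r" and v: "v \<in> V"
  shows "(\<lambda>n. norm ((((*v) A) ^^ n) v) / r ^ n) \<longlonglongrightarrow> 0"
proof (rule invariant_subspace_induct[OF V v, where Q = "\<lambda>v. (\<lambda>n. norm ((((*v) A) ^^ n) v) / r ^ n) \<longlonglongrightarrow> 0"])
  have "(((*v) A) ^^ n) 0 = 0" for n by (induction n) auto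
  then show "(\<lambda>n. norm ((((*v) A) ^^ n) 0) / r ^ n) \<longlonglongrightarrow> 0" by simp
next
  fix v z c
  define y where "y = A *v v - c *s v"
  assume step: "z \<in> V" "eigenvector A z c"
    "(\<lambda>n. norm ((((*v) A) ^^ n) (A *v v - c *s v)) / r ^ n) \<longlonglongrightarrow> 0"
  define d where "d n = norm ((((*v) A) ^^ n) y) / r ^ n / r" for n
  have "d \<longlonglongrightarrow> 0 / r"
    unfolding d_def y_def by (intro tendsto_divide step(3) tendsto_const) (use r(1) in simp)
  then have d: "d \<longlonglongrightarrow> 0" by simp
  have rec: "norm ((((*v) A) ^^ Suc n) v) / r ^ Suc n
      \<le> norm c / r * (norm ((((*v) A) ^^ n) v) / r ^ n) + d n" for n
  proof -
    have "(((*v) A) ^^ Suc n) v = (((*v) A) ^^ n) (c *s v + y)"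
      by (simp add: y_def funpow_Suc_right del: funpow.simps)
    also have "\<dots> = c *s (((*v) A) ^^ n) v + (((*v) A) ^^ n) y"
      by (simp only: funpow_matrix_add funpow_matrix_scale)
    finally have "norm ((((*v) A) ^^ Suc n) v)
        \<le> norm c * norm ((((*v) A) ^^ n) v) + norm ((((*v) A) ^^ n) y)"
      by (metis norm_triangle_ineq norm_vector_scale)
    then have "norm ((((*v) A) ^^ Suc n) v) / r ^ Suc n
        \<le> (norm c * norm ((((*v) A) ^^ n) v) + norm ((((*v) A) ^^ n) y)) / r ^ Suc n"
      using r(1) by (intro divide_right_mono) auto
    then show ?thesis
      by (simp add: d_def add_divide_distrib mult.commute)
  qed
  show "(\<lambda>n. norm ((((*v) A) ^^ n) v) / r ^ n) \<longlonglongrightarrow> 0"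
  proof (rule contracting_recurrence_tendsto_zero[OF _ _ _ _ d])
    show "norm c / r < 1" using r(1) r(2)[OF step(1,2)] by simp
    show "\<forall>\<^sub>F n in sequentially. norm ((((*v) A) ^^ Suc n) v) / r ^ Suc n
        \<le> norm c / r * (norm ((((*v) A) ^^ n) v) / r ^ n) + d n"
      using rec by (rule always_eventually[OF allI])
  qed (use r(1) in auto)
qed

subsection \<open>Adapted norms\<close>

text \<open>The lower comparison constant is normalised to 1, so that Euclidean norms can be
  replaced by \<open>N\<close> without a factor.\<close>

locale adapted_norm =
  fixes N :: "complex ^ 'k \<Rightarrow> real" and C :: real
  assumes N_add: "N (x + y) \<le> N x + N y"
    and N_scale: "N (c *s x) = norm c * N x"
    and norm_le_N: "norm x \<le> N x"
    and N_le_norm: "N x \<le> C * norm x"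
begin

lemma N_nonneg: "0 \<le> N x"
  using norm_le_N[of x] norm_ge_zero[of x] by linarith

lemma N_diff: "N (x - y) \<le> N x + N y"
  using N_add[of x "- y"] N_scale[of "- 1" y] by simp

lemma C_nonneg: "0 \<le> C"
proof -
  have "0 \<le> C * norm (axis undefined 1 :: complex ^ 'k)"
    using N_nonneg N_le_norm order_trans by blast
  then show ?thesis by (simp add: norm_axis_1)
qed

end

lemma funpow_matrix_norm_le: "norm ((((*v) A) ^^ n) x) \<le> norm A ^ n * norm x"
  for A :: "complex ^ 'k ^ 'k"
proof (induction n)
  case (Suc n)
  then show ?case
    using order_trans[OF norm_matrix_vector_mult_le[of A] mult_left_mono[OF Suc, of "norm A"]]
    by (simp add: mult.assoc)
qed simp

text \<open>Some power of \<open>A\<close> shrinks the kernel of \<open>l\<close> by the factor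
  \<open>r ^ M / 2\<close>. In the weighted sum of the norms of the first \<open>M\<close> iterates,
  applying \<open>A\<close> shifts the terms: the summand \<open>norm v\<close> is lost and one from
  the \<open>M\<close>-th iterate is gained, and the weights make the gain at most the loss.\<close>

lemma adapted_norm_exists:
  fixes A :: "complex ^ 'k ^ 'k"
  assumes lu: "bdot l u = 1" and r: "0 < r"
    and decay: "\<And>v. bdot l v = 0 \<Longrightarrow> (\<lambda>n. norm ((((*v) A) ^^ n) v) / r ^ n) \<longlonglongrightarrow> 0"
  obtains N C q where "adapted_norm N C" "0 \<le> q" "q < r"
    "\<And>v. bdot l v = 0 \<Longrightarrow> N (A *v v) \<le> q * N v"
proof -
  define f where "f n = ((*v) A) ^^ n" for n
  define pr where "pr v = v - bdot l v *s u" for v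
  have pr: "bdot l (pr v) = 0" for v
    by (simp add: pr_def bdot_simps lu)
  \<comment> \<open>Decay is known only vector by vector; summing over the images of a finite real
    basis under the projection gives a bound uniform on the kernel of \<open>l\<close>.\<close>
  define s where "s n = (\<Sum>b\<in>Basis. norm (f n (pr b)) / r ^ n)" for n
  have "s \<longlonglongrightarrow> (\<Sum>b\<in>(Basis :: (complex ^ 'k) set). 0)"
    unfolding s_def f_def by (intro tendsto_sum decay pr)
  then have "\<forall>\<^sub>F n in sequentially. s n < 1 / 2"
    by (intro order_tendstoD(2)) auto
  then have "\<forall>\<^sub>F n in sequentially. s n < 1 / 2 \<and> 1 \<le> n"
    by (intro eventually_conj eventually_ge_at_top)
  then obtain M where M: "s M < 1 / 2" "1 \<le> M"
    by (auto simp: eventually_sequentially)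
  have f_M: "norm (f M v) \<le> r ^ M / 2 * norm v" if "bdot l v = 0" for v
  proof -
    have lin: "linear (\<lambda>v. f M (pr v))"
    proof (rule linearI)
      have f_add: "f n (x + y) = f n x + f n y" for n x y
        unfolding f_def by (rule funpow_matrix_add)
      have pr_add: "pr (x + y) = pr x + pr y" for x y
        by (simp add: pr_def bdot_add_right vec.scale_left_distrib)
      show "f M (pr (x + y)) = f M (pr x) + f M (pr y)" for x y
        by (simp only: pr_add f_add)
      have R: "c *\<^sub>R x = complex_of_real c *s x" for c and x :: "complex ^ 'k"
        by (simp only: vec_eq_iff vector_scaleR_component vector_smult_component)
          (simp add: scaleR_conv_of_real)
      have pr_scale: "pr (c *s x) = c *s pr x" for c x
        by (simp add: pr_def bdot_scale_right vec.scale_right_diff_distrib)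
      show "f M (pr (c *\<^sub>R x)) = c *\<^sub>R f M (pr x)" for c x
        by (simp only: R pr_scale f_def funpow_matrix_scale)
    qed
    have "f M (pr (\<Sum>b\<in>Basis. (v \<bullet> b) *\<^sub>R b)) = (\<Sum>b\<in>Basis. (v \<bullet> b) *\<^sub>R f M (pr b))"
      by (simp only: linear_sum[OF lin] linear_scale[OF lin])
    moreover have "pr v = v" using that by (simp add: pr_def)
    ultimately have "norm (f M v) = norm (\<Sum>b\<in>Basis. (v \<bullet> b) *\<^sub>R f M (pr b))"
      by (simp add: euclidean_representation)
    also have "\<dots> \<le> (\<Sum>b\<in>Basis. norm v * norm (f M (pr b)))"
      by (rule order_trans[OF norm_sum], rule sum_mono)
        (simp add: Basis_le_norm mult_right_mono)
    also have "\<dots> = norm v * (r ^ M * s M)"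
      using r by (simp add: s_def sum_distrib_left)
    also have "\<dots> \<le> norm v * (r ^ M * (1 / 2))"
      using M r by (intro mult_left_mono) auto
    finally show ?thesis by (simp add: mult.commute)
  qed
  \<comment> \<open>With \<open>c ^ M = 2\<close> the weight \<open>(c / r) ^ M\<close> exactly
    cancels the factor \<open>r ^ M / 2\<close> in \<open>f_M\<close>, and \<open>c > 1\<close>
    leaves a rate \<open>r / c\<close> strictly below \<open>r\<close>.\<close>
  define c where "c = root M 2"
  have c: "1 < c" "c ^ M = 2"
    using M by (auto simp: c_def)
  define N where "N x = (\<Sum>j<M. (c / r) ^ j * norm (f j x))" for x
  show thesis
  proof (rule that)
    show "0 \<le> r / c" "r / c < r" using c r by (auto simp: field_simps)
    show "N (A *v v) \<le> r / c * N v" if v: "bdot l v = 0" for v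
    proof -
      have "r / c * ((c / r) ^ Suc j * norm (f (Suc j) v)) = (c / r) ^ j * norm (f j (A *v v))" for j
      proof -
        have "r / c * (c / r) ^ Suc j = (c / r) ^ j"
          using c r by simp
        then show ?thesis
          by (simp only: mult.assoc[symmetric] f_def funpow_Suc_right o_def)
      qed
      then have "N (A *v v) = r / c * (\<Sum>j<M. (c / r) ^ Suc j * norm (f (Suc j) v))"
        by (simp only: N_def sum_distrib_left)
      also have "(\<Sum>j<M. (c / r) ^ Suc j * norm (f (Suc j) v)) =
          N v + (c / r) ^ M * norm (f M v) - norm v"
        using sum.lessThan_Suc_shift[of "\<lambda>j. (c / r) ^ j * norm (f j v)" M]
        by (simp add: N_def f_def)
      finally have N_Av: "N (A *v v) = r / c * (N v + (c / r) ^ M * norm (f M v) - norm v)" .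
      have "(c / r) ^ M * norm (f M v) \<le> (c / r) ^ M * (r ^ M / 2 * norm v)"
        using c r by (intro mult_left_mono f_M v) auto
      also have "\<dots> = norm v"
        using c r by (simp add: power_divide)
      finally show ?thesis
        unfolding N_Av using c r by (intro mult_left_mono) auto
    qed
    show "adapted_norm N (\<Sum>j<M. (c / r) ^ j * norm A ^ j)"
    proof
      fix x y :: "complex ^ 'k" and a :: complex
      have cr: "0 \<le> (c / r) ^ j" for j using c r by simp
      have "N (x + y) \<le> (\<Sum>j<M. (c / r) ^ j * norm (f j x) + (c / r) ^ j * norm (f j y))"
        unfolding N_def distrib_left[symmetric]
        by (intro sum_mono mult_left_mono cr) (simp add: f_def funpow_matrix_add norm_triangle_ineq)
      then show "N (x + y) \<le> N x + N y" by (simp add: N_def sum.distrib)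
      show "N (a *s x) = norm a * N x"
        by (simp add: N_def f_def funpow_matrix_scale norm_vector_scale sum_distrib_left mult_ac)
      have "(\<lambda>j. (c / r) ^ j * norm (f j x)) 0 \<le> N x"
        unfolding N_def using M cr by (intro member_le_sum) auto
      then show "norm x \<le> N x" by (simp add: f_def)
      have "N x \<le> (\<Sum>j<M. (c / r) ^ j * (norm A ^ j * norm x))"
        unfolding N_def f_def by (intro sum_mono mult_left_mono cr funpow_matrix_norm_le)
      then show "N x \<le> (\<Sum>j<M. (c / r) ^ j * norm A ^ j) * norm x"
        by (simp add: sum_distrib_right mult.assoc)
    qed
  qed
qed

text \<open>\<open>N\<close> measures vectors in the kernel of \<open>l\<close>, and
  \<open>N'\<close> measures covectors annihilating \<open>u\<close>. Both share \<open>C\<close>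
  and \<open>q\<close>, which can be arranged by taking maxima.\<close>

locale dominant_splitting =
  forward: adapted_norm N C + backward: adapted_norm N' C
  for N N' :: "complex ^ 'k \<Rightarrow> real" and C :: real +
  fixes A :: "complex ^ 'k ^ 'k" and lam :: complex and u l :: "complex ^ 'k" and q :: real
  assumes A_u: "A *v u = lam *s u" and A_l: "transpose A *v l = lam *s l" and lu: "bdot l u = 1"
    and q: "0 \<le> q" "q < norm lam"
    and N_A: "bdot l v = 0 \<Longrightarrow> N (A *v v) \<le> q * N v"
    and N'_A: "bdot y u = 0 \<Longrightarrow> N' (transpose A *v y) \<le> q * N' y"

lemma subspace_bdot: "vec.subspace {v. bdot l v = 0}"
  for l :: "'a::field ^ 'k"
  by (simp add: vec.subspace_def bdot_simps)

lemma left_eigenvector_exists: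
  assumes "eigenvector A u c"
  obtains l where "l \<noteq> 0" "transpose A *v l = c *s l"
  using assms eigenvalue_transpose[of A c] by (auto simp: eigenvalue_def eigenvector_def)

lemma norm_eigenvalue_less:
  assumes "{c. max_modulus_eigenvalue A c} = {lam}" "eigenvalue A d" "d \<noteq> lam"
  shows "norm d < norm lam"
proof (rule ccontr)
  assume "\<not> norm d < norm lam"
  then have "max_modulus_eigenvalue A d"
    using assms(1,2) unfolding max_modulus_eigenvalue_def by (smt (verit) mem_Collect_eq singletonI)
  with assms show False by blast
qed

text \<open>If \<open>lam\<close> were 0, every other eigenvalue would have negative modulus. The
  kernel of \<open>l\<close> would then contain no eigenvector, so the induction over linear factors
  makes it trivial and all vectors are multiples of \<open>u\<close>. The two distinct points
  express that the dimension is at least 2.\<close>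

lemma dominant_eigenvalue_nonzero:
  fixes A :: "complex ^ 'k ^ 'k"
  assumes dom: "{c. max_modulus_eigenvalue A c} = {lam}" and simple: "simple_eigenvalue A lam"
    and u: "eigenvector A u lam" and nontriv: "p \<noteq> (p' :: 'k proj)"
  shows "lam \<noteq> 0"
proof
  assume lam: "lam = 0"
  obtain l where l: "l \<noteq> 0" "transpose A *v l = lam *s l"
    using left_eigenvector_exists[OF u] .
  have nz: "bdot l v \<noteq> 0" if "eigenvector A v lam" for v
    using simple_eigenvalue_bdot_nonzero[of lam A v l] simple that l
    by (auto simp: simple_eigenvalue_def eigenvector_def)
  have lA: "bdot l (A *v v) = lam * bdot l v" for v
    by (metis bdot_transpose l(2) bdot_scale_left)
  have V0: "v = 0" if "bdot l v = 0" for v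
  proof (rule invariant_subspace_induct[of "{v. bdot l v = 0}" A v "\<lambda>v. v = 0"])
    fix v z c assume z: "z \<in> {v. bdot l v = 0}" "eigenvector A z c"
    then have "c \<noteq> lam" using nz by auto
    then have "norm c < norm lam"
      using norm_eigenvalue_less[OF dom] z by (auto simp: eigenvalue_def)
    then show "v = 0" using lam by simp
  qed (use that lA subspace_bdot in auto)
  have "proj_class v = proj_class u" if "v \<noteq> 0" for v
  proof -
    have "v - (bdot l v / bdot l u) *s u = 0"
      using nz[OF u] by (intro V0) (simp add: bdot_simps)
    then have v: "v = (bdot l v / bdot l u) *s u" by simp
    with that have "bdot l v / bdot l u \<noteq> 0" by auto
    with v show ?thesis by (metis proj_class_scale)
  qed
  with nontriv show False by (metis proj_class_surj)
qed

lemma dominant_splitting_exists: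
  fixes A :: "complex ^ 'k ^ 'k"
  assumes dom: "{c. max_modulus_eigenvalue A c} = {lam}" and simple: "simple_eigenvalue A lam"
    and u: "eigenvector A u lam" and lam: "lam \<noteq> 0"
  obtains N N' C l q where "dominant_splitting N N' C A lam u l q"
proof -
  have u': "u \<noteq> 0" "A *v u = lam *s u" using u by (auto simp: eigenvector_def)
  obtain l0 where l0: "l0 \<noteq> 0" "transpose A *v l0 = lam *s l0"
    using left_eigenvector_exists[OF u] .
  have ord: "order lam (charpoly A) = 1"
    using simple by (simp add: simple_eigenvalue_def)
  have nz: "bdot w v \<noteq> 0"
    if "v \<noteq> 0" "A *v v = lam *s v" "w \<noteq> 0" "transpose A *v w = lam *s w" for v w
    using simple_eigenvalue_bdot_nonzero[OF ord that(2,1,4,3)] .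
  define l where "l = (1 / bdot l0 u) *s l0"
  have lu0: "bdot l0 u \<noteq> 0" using nz u' l0 by blast
  have l: "l \<noteq> 0" "transpose A *v l = lam *s l" "bdot l u = 1"
    using l0 lu0 by (auto simp: l_def matrix_vector_scale bdot_scale_left mult.commute)
  have ul: "bdot u l = 1" using l by (simp add: bdot_commute)
  \<comment> \<open>An eigenvector in the kernel of \<open>w\<close> cannot belong to
    \<open>lam\<close>, since left and right eigenvectors for \<open>lam\<close> pair to a nonzero
    number. One argument serves both \<open>A\<close> and its transpose.\<close>
  have decay: "(\<lambda>n. norm ((((*v) B) ^^ n) v) / norm lam ^ n) \<longlonglongrightarrow> 0"
    if B: "B = A \<and> w = l \<or> B = transpose A \<and> w = u" and v: "bdot w v = 0" for B w v
  proof (rule funpow_decay[of "{v. bdot w v = 0}"])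
    have wB: "transpose B *v w = lam *s w" using B l u' by auto
    have wA: "bdot w (B *v v) = lam * bdot w v" for v
      by (metis bdot_transpose wB bdot_scale_left)
    show "B *v v \<in> {v. bdot w v = 0}" if "v \<in> {v. bdot w v = 0}" for v
      using that by (simp add: wA)
    show "norm c < norm lam" if "z \<in> {v. bdot w v = 0}" "eigenvector B z c" for z c
    proof -
      have "c \<noteq> lam"
        using that B nz[of z l] nz[of u z] l u' by (auto simp: eigenvector_def bdot_commute)
      moreover have "eigenvalue A c"
        using that(2) B eigenvalue_transpose[of A c] by (auto simp: eigenvalue_def)
      ultimately show ?thesis using norm_eigenvalue_less[OF dom] by blast
    qed
  qed (use lam v subspace_bdot in auto)
  obtain N C q where N: "adapted_norm N C" "0 \<le> q" "q < norm lam"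
      "\<And>v. bdot l v = 0 \<Longrightarrow> N (A *v v) \<le> q * N v"
    using adapted_norm_exists[OF l(3), of "norm lam" A] decay[of A l] lam by auto
  obtain N' C' q' where N': "adapted_norm N' C'" "0 \<le> q'" "q' < norm lam"
      "\<And>v. bdot u v = 0 \<Longrightarrow> N' (transpose A *v v) \<le> q' * N' v"
    using adapted_norm_exists[OF ul, of "norm lam" "transpose A"] decay[of "transpose A" u] lam
    by auto
  interpret N: adapted_norm N C by fact
  interpret N': adapted_norm N' C' by fact
  have "C * norm x \<le> max C C' * norm x" "C' * norm x \<le> max C C' * norm x" for x :: "complex ^ 'k"
    by (intro mult_right_mono; simp)+
  then have "N x \<le> max C C' * norm x" "N' x \<le> max C C' * norm x" for x
    using N.N_le_norm N'.N_le_norm order_trans by blast+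
  then have "adapted_norm N (max C C')" "adapted_norm N' (max C C')"
    by (auto intro!: adapted_norm.intro N.N_add N'.N_add N.N_scale N'.N_scale
        N.norm_le_N N'.norm_le_N)
  moreover have "N (A *v v) \<le> max q q' * N v" if "bdot l v = 0" for v
    using N(4)[OF that] N.N_nonneg by (meson max.cobounded1 mult_right_mono order_trans)
  moreover have "N' (transpose A *v v) \<le> max q q' * N' v" if "bdot v u = 0" for v
    using N'(4)[of v] that N'.N_nonneg
    by (metis bdot_commute max.cobounded2 mult_right_mono order_trans)
  ultimately have "dominant_splitting N N' (max C C') A lam u l (max q q')"
    using N(2,3) N'(2,3) l u'
    by (simp add: dominant_splitting_def dominant_splitting_axioms_def le_max_iff_disj)
  then show thesis by (rule that)
qed

declare transpose_matrix_vector [simp del]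

subsection \<open>The backward contraction\<close>

lemma matrix_diff_split: "B *v v = A *v v + (B - A) *v v" for A B :: "'a::ring_1 ^ 'k ^ 'm"
  by (simp add: matrix_vector_mult_diff_rdistrib)

lemma continuous_on_bdot [continuous_intros]:
  fixes f g :: "_ \<Rightarrow> complex ^ 'k"
  assumes "continuous_on S f" "continuous_on S g"
  shows "continuous_on S (\<lambda>x. bdot (f x) (g x))"
  unfolding bdot_def by (intro continuous_intros assms)

lemma continuous_on_matrix_vector_mult [continuous_intros]:
  fixes f :: "_ \<Rightarrow> complex ^ 'k ^ 'm"
  assumes "continuous_on S f" "continuous_on S g"
  shows "continuous_on S (\<lambda>x. f x *v g x)"
  unfolding matrix_vector_mult_def by (intro continuous_intros assms)

lemma continuous_on_vector_scale [continuous_intros]: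
  fixes f :: "_ \<Rightarrow> complex" and g :: "_ \<Rightarrow> complex ^ 'k"
  assumes "continuous_on S f" "continuous_on S g"
  shows "continuous_on S (\<lambda>x. f x *s g x)"
  unfolding vector_scalar_mult_def by (intro continuous_intros assms)

lemma continuous_on_transpose [continuous_intros]:
  fixes f :: "_ \<Rightarrow> complex ^ 'k ^ 'm"
  assumes "continuous_on S f"
  shows "continuous_on S (\<lambda>x. transpose (f x))"
  unfolding transpose_def by (intro continuous_intros assms)

lemma continuous_on_matrix_mult [continuous_intros]:
  fixes f :: "_ \<Rightarrow> complex ^ 'k ^ 'm" and g :: "_ \<Rightarrow> complex ^ 'n ^ 'k"
  assumes "continuous_on S f" "continuous_on S g"
  shows "continuous_on S (\<lambda>x. f x ** g x)"
  unfolding matrix_matrix_mult_def by (intro continuous_intros assms)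

text \<open>The map with index \<open>m + n - 1\<close> acts first and the one with index
  \<open>m\<close> last, as for the transpose of a product. Increasing \<open>n\<close> inserts maps
  on the inside, so contraction of the outer ones forces convergence.\<close>

primrec nest :: "(nat \<Rightarrow> 'a \<Rightarrow> 'a) \<Rightarrow> 'a \<Rightarrow> nat \<Rightarrow> nat \<Rightarrow> 'a"
  where
    "nest F z m 0 = z"
  | "nest F z m (Suc n) = F m (nest F z (Suc m) n)"

lemma nest_constant: "nest (\<lambda>_. f) z m n = nest (\<lambda>_. f) z 0 n"
proof (induction n arbitrary: m)
  case (Suc n)
  show ?case using Suc[of "Suc m"] Suc[of "Suc 0"] by simp
qed simp

context dominant_splitting
begin

text \<open>The affine chart \<open>bdot y u = 1\<close> of the dual projective space, cut to a unit ball around \<open>l\<close>; the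
  projective action of the transpose of \<open>B\<close> becomes \<open>dual_step B\<close> in this chart.\<close>

definition slice :: "(complex ^ 'k) set"
  where "slice = {y. bdot y u = 1 \<and> N' (y - l) \<le> 1}"

definition dual_step :: "complex ^ 'k ^ 'k \<Rightarrow> complex ^ 'k \<Rightarrow> complex ^ 'k"
  where "dual_step B y = (1 / bdot y (B *v u)) *s (transpose B *v y)"

text \<open>Bounds the projection along \<open>u\<close> onto the kernel of \<open>l\<close>, from
  the Euclidean norm to \<open>N\<close>.\<close>

definition Cpr :: real
  where "Cpr = C * (1 + norm l * norm u)"

text \<open>The sum of all constants by which \<open>norm (B - A)\<close> is multiplied in the estimates below.\<close>

definition Knear :: real
  where "Knear = C + norm u * (C * (norm l + 1)) + C * (norm l + 1)
    + (norm l + 1) * norm u * (C * norm l) + (norm l + 1) * norm u + Cpr + Cpr * norm u"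

definition gap :: real
  where "gap = norm lam - q"

definition near :: "complex ^ 'k ^ 'k \<Rightarrow> bool"
  where "near B \<longleftrightarrow> norm (B - A) * Knear \<le> gap / 4"

text \<open>A perturbation may use a quarter of the gap in the numerator and a quarter in the
  denominator; half of the gap still separates them.\<close>

definition rate :: real
  where "rate = (q + gap / 4) / (norm lam - gap / 4)"

lemma gap_pos: "0 < gap"
  using q by (simp add: gap_def)

lemma lower_pos: "0 < norm lam - gap / 4"
  using q by (simp add: gap_def)

lemma rate: "0 \<le> rate" "rate < 1"
proof -
  have "q + gap / 4 < norm lam - gap / 4"
    using q by (simp add: gap_def field_simps)
  then show "0 \<le> rate" "rate < 1"
    unfolding rate_def using q gap_pos lower_pos by auto
qed

lemma Cpr_nonneg: "0 \<le> Cpr"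
  unfolding Cpr_def using forward.C_nonneg by simp

lemma near_exists: "\<exists>e>0. \<forall>B. norm (B - A) \<le> e \<longrightarrow> near B"
proof -
  have K: "0 \<le> Knear"
    unfolding Knear_def using forward.C_nonneg Cpr_nonneg by (intro add_nonneg_nonneg mult_nonneg_nonneg) auto
  have "norm (B - A) * Knear \<le> gap / 4" if "norm (B - A) \<le> gap / (4 * (Knear + 1))" for B
  proof -
    have "norm (B - A) * Knear \<le> gap / (4 * (Knear + 1)) * (Knear + 1)"
      using K that gap_pos by (intro mult_mono) auto
    also have "\<dots> = gap / 4"
      using K by (simp add: divide_simps)
    finally show ?thesis .
  qed
  moreover have "0 < gap / (4 * (Knear + 1))" using gap_pos K by simp
  ultimately show ?thesis unfolding near_def by blast
qed

text \<open>All summands of \<open>Knear\<close> are nonnegative, so each partial sum inherits the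
  bound. In order, the five bounds serve contraction, invariance of the slice, the denominator, and
  the two error terms in \<open>slice_eigenvector_pairing\<close>.\<close>

lemma near_bounds:
  assumes "near B"
  defines "d \<equiv> norm (B - A)"
  shows "d * C + d * (norm u * (C * (norm l + 1))) \<le> gap / 4"
    "d * (C * (norm l + 1)) + d * ((norm l + 1) * norm u * (C * norm l)) \<le> gap / 4"
    "d * ((norm l + 1) * norm u) \<le> gap / 4" "d * Cpr \<le> gap / 4" "d * (Cpr * norm u) \<le> gap / 4"
proof -
  have d: "0 \<le> d" by (simp add: d_def)
  note C = forward.C_nonneg Cpr_nonneg
  have nn: "0 \<le> d * C" "0 \<le> d * (norm u * (C * (norm l + 1)))" "0 \<le> d * (C * (norm l + 1))"
    "0 \<le> d * ((norm l + 1) * norm u * (C * norm l))" "0 \<le> d * ((norm l + 1) * norm u)"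
    "0 \<le> d * Cpr" "0 \<le> d * (Cpr * norm u)"
    using d C by (auto intro!: mult_nonneg_nonneg)
  have "d * C + d * (norm u * (C * (norm l + 1))) + d * (C * (norm l + 1))
    + d * ((norm l + 1) * norm u * (C * norm l)) + d * ((norm l + 1) * norm u) + d * Cpr
    + d * (Cpr * norm u) \<le> gap / 4"
    using assms(1) by (simp only: near_def Knear_def d_def distrib_left)
  with nn show "d * C + d * (norm u * (C * (norm l + 1))) \<le> gap / 4"
    "d * (C * (norm l + 1)) + d * ((norm l + 1) * norm u * (C * norm l)) \<le> gap / 4"
    "d * ((norm l + 1) * norm u) \<le> gap / 4" "d * Cpr \<le> gap / 4" "d * (Cpr * norm u) \<le> gap / 4"
    by linarith+
qed

lemma l_slice: "l \<in> slice"
  using backward.N_scale[of 0 l] by (simp add: slice_def lu)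

lemma slice_norm:
  assumes "y \<in> slice" shows "norm y \<le> norm l + 1"
proof -
  have "norm y \<le> norm l + norm (y - l)" by (metis add.commute diff_add_cancel norm_triangle_ineq)
  also have "norm (y - l) \<le> 1"
    using backward.norm_le_N[of "y - l"] assms by (simp add: slice_def)
  finally show ?thesis by simp
qed

lemma slice_pairing: "bdot y (B *v u) = lam * bdot y u + bdot y ((B - A) *v u)"
  by (simp add: matrix_diff_split[of B u A] bdot_simps A_u)

lemma norm_pairing_le: "norm (bdot y (E *v v)) \<le> norm y * (norm E * norm v)"
  for E :: "complex ^ 'k ^ 'm"
  by (rule order_trans[OF norm_bdot_le]) (intro mult_left_mono norm_matrix_vector_mult_le norm_ge_zero)

lemma norm_transpose_mult_le: "norm (transpose E *v y) \<le> norm E * norm y"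
  for E :: "complex ^ 'k ^ 'm"
  using norm_matrix_vector_mult_le[of "transpose E" y] by (simp add: norm_transpose)

lemma N'_transpose_mult_le: "N' (transpose E *v y) \<le> C * (norm E * norm y)"
  by (rule order_trans[OF backward.N_le_norm mult_left_mono[OF norm_transpose_mult_le forward.C_nonneg]])

lemma slice_pairing_diff:
  assumes "y \<in> slice"
  shows "norm (bdot y (B *v u) - lam) \<le> norm (B - A) * ((norm l + 1) * norm u)"
proof -
  have "norm (bdot y (B *v u) - lam) \<le> norm y * (norm (B - A) * norm u)"
    using assms norm_pairing_le[of y "B - A" u] by (simp add: slice_pairing[of y B] slice_def)
  also have "\<dots> \<le> (norm l + 1) * (norm (B - A) * norm u)"
    using slice_norm[OF assms] by (intro mult_right_mono) auto
  finally show ?thesis by (simp add: mult_ac)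
qed

lemma slice_pairing_lower:
  assumes "near B" "y \<in> slice"
  shows "norm lam - gap / 4 \<le> norm (bdot y (B *v u))"
  using slice_pairing_diff[OF assms(2), of B] near_bounds(3)[OF assms(1)]
    norm_triangle_ineq2[of lam "bdot y (B *v u)"] by (simp add: norm_minus_commute)

lemma slice_pairing_nonzero:
  assumes "near B" "y \<in> slice" shows "bdot y (B *v u) \<noteq> 0"
  using slice_pairing_lower[OF assms] lower_pos by auto

lemma transpose_dual_step:
  assumes "near B" "y \<in> slice"
  shows "transpose B *v y = bdot y (B *v u) *s dual_step B y"
  using slice_pairing_nonzero[OF assms] by (simp add: dual_step_def)

lemma rate_scale:
  fixes a :: complex
  assumes "norm lam - gap / 4 \<le> norm a" "x \<le> (q + gap / 4) * e" "0 \<le> e"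
  shows "norm (1 / a) * x \<le> rate * e"
proof -
  have a: "0 < norm a" using assms(1) lower_pos by linarith
  have "norm (1 / a) * x \<le> norm (1 / a) * ((q + gap / 4) * e)"
    using assms(2) by (intro mult_left_mono) auto
  also have "\<dots> = (q + gap / 4) * e / norm a"
    by (simp add: norm_divide)
  also have "\<dots> \<le> (q + gap / 4) * e / (norm lam - gap / 4)"
    using assms(1,3) lower_pos q gap_pos a by (intro divide_left_mono mult_pos_pos mult_nonneg_nonneg) auto
  finally show ?thesis by (simp add: rate_def)
qed

text \<open>Before division by \<open>a\<close>, the deviation from \<open>l\<close> is the image of
  \<open>y - l\<close> under the transpose of \<open>A\<close>, contracted by \<open>q\<close>
  because \<open>y - l\<close> annihilates \<open>u\<close>, plus terms of the order of
  \<open>norm (B - A)\<close>.\<close>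

lemma dual_step_slice:
  assumes B: "near B" and y: "y \<in> slice"
  shows "dual_step B y \<in> slice"
proof -
  define a where "a = bdot y (B *v u)"
  define E where "E = B - A"
  have a: "a \<noteq> 0" unfolding a_def by (rule slice_pairing_nonzero[OF assms])
  have yl: "bdot (y - l) u = 0" "N' (y - l) \<le> 1" using y by (auto simp: slice_def bdot_simps lu)
  have tB: "transpose B *v v = transpose A *v v + transpose E *v v" for v
    by (simp add: E_def transpose_diff matrix_vector_mult_diff_rdistrib)
  have "transpose B *v y - a *s l = transpose A *v (y - l) + (transpose E *v y - (a - lam) *s l)"
    by (simp add: tB matrix_vector_mult_diff_distrib A_l vec.scale_left_diff_distrib)
  then have "N' (transpose B *v y - a *s l)
      \<le> N' (transpose A *v (y - l)) + (N' (transpose E *v y) + N' ((a - lam) *s l))"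
    by (simp only:) (rule order_trans[OF backward.N_add add_left_mono[OF backward.N_diff]])
  also have "N' (transpose A *v (y - l)) \<le> q"
    using N'_A[OF yl(1)] mult_left_mono[OF yl(2) q(1)] by simp
  also have "N' (transpose E *v y) \<le> norm E * (C * (norm l + 1))"
  proof -
    have "N' (transpose E *v y) \<le> C * (norm E * norm y)"
      by (rule N'_transpose_mult_le)
    also have "\<dots> \<le> C * (norm E * (norm l + 1))"
      using slice_norm[OF y] forward.C_nonneg by (intro mult_left_mono) auto
    finally show ?thesis by (simp add: mult_ac)
  qed
  also have "N' ((a - lam) *s l) \<le> norm E * ((norm l + 1) * norm u * (C * norm l))"
  proof -
    have "N' ((a - lam) *s l) \<le> norm (a - lam) * (C * norm l)"
      unfolding backward.N_scale by (intro mult_left_mono backward.N_le_norm) auto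
    also have "\<dots> \<le> norm E * ((norm l + 1) * norm u) * (C * norm l)"
      unfolding a_def E_def
      by (intro mult_right_mono slice_pairing_diff[OF y] mult_nonneg_nonneg forward.C_nonneg) auto
    finally show ?thesis by (simp add: mult_ac)
  qed
  also have "q + (norm E * (C * (norm l + 1)) + norm E * ((norm l + 1) * norm u * (C * norm l)))
      \<le> (q + gap / 4) * 1"
    using near_bounds(2)[OF B] by (simp add: E_def)
  finally have "norm (1 / a) * N' (transpose B *v y - a *s l) \<le> rate * 1"
    unfolding a_def by (intro rate_scale slice_pairing_lower assms) auto
  moreover have "dual_step B y - l = (1 / a) *s (transpose B *v y - a *s l)"
    using a by (simp add: dual_step_def a_def vec.scale_right_diff_distrib)
  ultimately have "N' (dual_step B y - l) \<le> 1"
    using rate(2) by (simp only: backward.N_scale)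
  moreover have "bdot (dual_step B y) u = 1"
    using a by (simp add: dual_step_def bdot_scale_left bdot_transpose a_def)
  ultimately show ?thesis by (simp add: slice_def)
qed

text \<open>Differences in the slice annihilate \<open>u\<close>, so the transpose of
  \<open>A\<close> contracts them. The normalising factors do no harm: since \<open>u\<close> is an
  eigenvector of \<open>A\<close>, their difference \<open>a - b\<close> sees only the perturbation
  \<open>E\<close>.\<close>

lemma dual_step_contract:
  assumes B: "near B" and y: "y \<in> slice" and z: "z \<in> slice"
  shows "N' (dual_step B y - dual_step B z) \<le> rate * N' (y - z)"
proof -
  define a where "a = bdot y (B *v u)"
  define b where "b = bdot z (B *v u)"
  define E where "E = B - A"
  have nz: "a \<noteq> 0" "b \<noteq> 0" unfolding a_def b_def by (rule slice_pairing_nonzero; fact)+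
  have yz: "bdot (y - z) u = 0" using y z by (simp add: slice_def bdot_simps)
  have "transpose B *v (y - z) = transpose A *v (y - z) + transpose E *v (y - z)"
    by (simp add: E_def transpose_diff matrix_vector_mult_diff_rdistrib)
  then have "N' (transpose B *v (y - z)) \<le> N' (transpose A *v (y - z)) + N' (transpose E *v (y - z))"
    by (simp only:) (rule backward.N_add)
  also have "N' (transpose A *v (y - z)) \<le> q * N' (y - z)"
    by (rule N'_A[OF yz])
  also have "N' (transpose E *v (y - z)) \<le> C * (norm E * norm (y - z))"
    by (rule N'_transpose_mult_le)
  also have "\<dots> \<le> C * (norm E * N' (y - z))"
    by (intro mult_left_mono backward.norm_le_N norm_ge_zero forward.C_nonneg)
  finally have 1: "N' (transpose B *v (y - z)) \<le> q * N' (y - z) + C * (norm E * N' (y - z))"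
    by simp
  have ab: "a - b = bdot (y - z) (E *v u)"
    unfolding a_def b_def bdot_diff_left[symmetric] slice_pairing[of "y - z" B] yz E_def by simp
  have "norm (a - b) \<le> norm (y - z) * (norm E * norm u)"
    unfolding ab by (rule norm_pairing_le)
  also have "\<dots> \<le> N' (y - z) * (norm E * norm u)"
    by (intro mult_right_mono backward.norm_le_N) auto
  finally have ab': "norm (a - b) \<le> N' (y - z) * (norm E * norm u)" .
  have Fz: "N' (dual_step B z) \<le> C * (norm l + 1)"
    by (rule order_trans[OF backward.N_le_norm mult_left_mono[OF
      slice_norm[OF dual_step_slice[OF B z]] forward.C_nonneg]])
  have "N' (transpose B *v (y - z) - (a - b) *s dual_step B z)
      \<le> N' (transpose B *v (y - z)) + norm (a - b) * N' (dual_step B z)"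
    by (rule order_trans[OF backward.N_diff]) (simp only: backward.N_scale order_refl)
  also have "\<dots> \<le> q * N' (y - z) + C * (norm E * N' (y - z))
      + N' (y - z) * (norm E * norm u) * (C * (norm l + 1))"
    using backward.N_nonneg by (intro add_mono 1 mult_mono ab' Fz mult_nonneg_nonneg) auto
  also have "\<dots> = (q + (norm E * C + norm E * (norm u * (C * (norm l + 1))))) * N' (y - z)"
    by (simp add: algebra_simps)
  also have "\<dots> \<le> (q + gap / 4) * N' (y - z)"
    using near_bounds(1)[OF B] backward.N_nonneg by (intro mult_right_mono) (auto simp: E_def)
  finally have "norm (1 / a) * N' (transpose B *v (y - z) - (a - b) *s dual_step B z) \<le> rate * N' (y - z)"
    unfolding a_def by (intro rate_scale slice_pairing_lower B y backward.N_nonneg) auto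
  moreover have "dual_step B y - dual_step B z = (1 / a) *s (transpose B *v (y - z) - (a - b) *s dual_step B z)"
  proof -
    have "transpose B *v y = a *s dual_step B y" "transpose B *v z = b *s dual_step B z"
      unfolding a_def b_def by (rule transpose_dual_step; fact)+
    then have "transpose B *v (y - z) - (a - b) *s dual_step B z = a *s (dual_step B y - dual_step B z)"
      by (simp add: matrix_vector_mult_diff_distrib vec.scale_left_diff_distrib vec.scale_right_diff_distrib)
    then show ?thesis using nz by (simp only: vec.scale_scale) simp
  qed
  ultimately show ?thesis by (simp only: backward.N_scale)
qed

section \<open>Limits of nested backward steps\<close>

lemma nest_slice:
  assumes "\<And>m. near (B m)"
  shows "nest (\<lambda>m. dual_step (B m)) l m n \<in> slice"
  by (induction n arbitrary: m) (auto intro: l_slice dual_step_slice assms)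

lemma slice_diameter:
  assumes "y \<in> slice" "z \<in> slice" shows "N' (y - z) \<le> 2"
  using backward.N_diff[of "y - l" "z - l"] assms by (simp add: slice_def)

text \<open>The two compositions share their \<open>n\<close> outermost maps, and their inner points
  lie in a slice of diameter at most 2.\<close>

lemma nest_cauchy:
  assumes B: "\<And>m. near (B m)"
  shows "N' (nest (\<lambda>m. dual_step (B m)) l m (n + k) - nest (\<lambda>m. dual_step (B m)) l m n) \<le> rate ^ n * 2"
proof (induction n arbitrary: m)
  case 0
  show ?case
    by (simp only: power_0 mult_1 nest.simps add_0) (rule slice_diameter[OF nest_slice[OF B] l_slice])
next
  case (Suc n)
  have "N' (nest (\<lambda>m. dual_step (B m)) l m (Suc n + k) - nest (\<lambda>m. dual_step (B m)) l m (Suc n))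
    \<le> rate * N' (nest (\<lambda>m. dual_step (B m)) l (Suc m) (n + k) - nest (\<lambda>m. dual_step (B m)) l (Suc m) n)"
    by (simp only: add_Suc nest.simps)
      (rule dual_step_contract[OF B nest_slice[OF B] nest_slice[OF B]])
  also have "\<dots> \<le> rate * (rate ^ n * 2)"
    by (intro mult_left_mono Suc rate)
  finally show ?case by (simp only: power_Suc mult.assoc)
qed

definition dual_limit :: "(nat \<Rightarrow> complex ^ 'k ^ 'k) \<Rightarrow> nat \<Rightarrow> complex ^ 'k"
  where "dual_limit B m = lim (nest (\<lambda>m. dual_step (B m)) l m)"

lemma nest_limit:
  assumes B: "\<And>m. near (B m)"
  shows "nest (\<lambda>m. dual_step (B m)) l m \<longlonglongrightarrow> dual_limit B m" (is ?lim)
    and "norm (nest (\<lambda>m. dual_step (B m)) l m n - dual_limit B m) \<le> rate ^ n * 2"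
proof -
  let ?y = "nest (\<lambda>m. dual_step (B m)) l m"
  have bound: "norm (?y (n + k) - ?y n) \<le> rate ^ n * 2" for n k
    by (rule order_trans[OF backward.norm_le_N nest_cauchy[OF B]])
  have "(\<lambda>n. rate ^ n * 2) \<longlonglongrightarrow> 0 * 2"
    by (intro tendsto_intros LIMSEQ_realpow_zero rate)
  then have small: "\<forall>\<^sub>F n in sequentially. rate ^ n * 2 < e" if "0 < e" for e
    using that by (intro order_tendstoD(2)) auto
  have "Cauchy ?y"
  proof (rule CauchyI')
    fix e :: real assume "0 < e"
    then obtain M where M: "rate ^ n * 2 < e" if "n \<ge> M" for n
      using small by (auto simp: eventually_sequentially)
    have "dist (?y m) (?y n) < e" if "m \<ge> M" "n > m" for m n
      using bound[of m "n - m"] M[OF that(1)] that by (simp add: dist_norm norm_minus_commute)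
    then show "\<exists>M. \<forall>m\<ge>M. \<forall>n>m. dist (?y m) (?y n) < e" by blast
  qed
  then show lim: ?lim
    by (simp add: dual_limit_def Cauchy_convergent_iff convergent_LIMSEQ_iff)
  have "(\<lambda>k. ?y (n + k)) \<longlonglongrightarrow> dual_limit B m"
    using LIMSEQ_ignore_initial_segment[OF lim, of n] by (simp add: add.commute)
  then have "(\<lambda>k. norm (?y (n + k) - ?y n)) \<longlonglongrightarrow> norm (dual_limit B m - ?y n)"
    by (intro tendsto_intros)
  then have "norm (dual_limit B m - ?y n) \<le> rate ^ n * 2"
    by (rule tendsto_upperbound) (auto simp: bound)
  then show "norm (?y n - dual_limit B m) \<le> rate ^ n * 2"
    by (simp add: norm_minus_commute)
qed

lemma N'_tendsto_zero:
  assumes "(f \<longlongrightarrow> a) F" shows "((\<lambda>x. N' (f x - a)) \<longlongrightarrow> 0) F"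
proof (rule tendsto_sandwich[of "\<lambda>_. 0" _ _ "\<lambda>x. C * norm (f x - a)"])
  show "((\<lambda>x. C * norm (f x - a)) \<longlongrightarrow> 0) F"
    using tendsto_mult_right_zero[OF tendsto_norm_zero[OF LIM_zero[OF assms]]] by simp
qed (auto simp: backward.N_nonneg backward.N_le_norm)

lemma dual_limit_slice:
  assumes B: "\<And>m. near (B m)"
  shows "dual_limit B m \<in> slice"
proof -
  let ?y = "nest (\<lambda>m. dual_step (B m)) l m"
  have y: "?y n \<in> slice" for n by (rule nest_slice[OF B])
  have lim: "?y \<longlonglongrightarrow> dual_limit B m" by (rule nest_limit(1)[OF B])
  have "(\<lambda>n. bdot (?y n) u) \<longlonglongrightarrow> bdot (dual_limit B m) u"
    unfolding bdot_def by (intro tendsto_intros lim)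
  then have "bdot (dual_limit B m) u = 1"
    using y by (simp add: slice_def LIMSEQ_const_iff)
  \<comment> \<open>The bound passes to the limit because \<open>N'\<close> of the error tends to
    zero, being dominated by \<open>C\<close> times its Euclidean norm.\<close>
  moreover have "N' (dual_limit B m - l) \<le> 1"
  proof (rule tendsto_lowerbound)
    show "(\<lambda>n. 1 + N' (?y n - dual_limit B m)) \<longlonglongrightarrow> 1"
      using tendsto_add[OF tendsto_const N'_tendsto_zero[OF lim], of 1] by simp
    have "N' (dual_limit B m - l) \<le> 1 + N' (?y n - dual_limit B m)" for n
      using backward.N_diff[of "?y n - l" "?y n - dual_limit B m"] y[of n] by (simp add: slice_def)
    then show "\<forall>\<^sub>F n in sequentially. N' (dual_limit B m - l) \<le> 1 + N' (?y n - dual_limit B m)"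
      by simp
  qed simp
  ultimately show ?thesis by (simp add: slice_def)
qed

text \<open>Contraction makes \<open>dual_step (B m)\<close> continuous along the approximants. The
  result is the covector recurrence needed for \<open>forward_direction\<close>.\<close>

lemma dual_limit_step:
  assumes B: "\<And>m. near (B m)"
  shows "dual_step (B m) (dual_limit B (Suc m)) = dual_limit B m"
proof -
  let ?y = "nest (\<lambda>m. dual_step (B m)) l"
  have lim: "?y m \<longlonglongrightarrow> dual_limit B m" for m by (rule nest_limit(1)[OF B])
  have "(\<lambda>n. rate * N' (?y (Suc m) n - dual_limit B (Suc m))) \<longlonglongrightarrow> rate * 0"
    by (intro tendsto_intros N'_tendsto_zero lim)
  then have rate_lim: "(\<lambda>n. rate * N' (?y (Suc m) n - dual_limit B (Suc m))) \<longlonglongrightarrow> 0"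
    by simp
  have "norm (?y m (Suc n) - dual_step (B m) (dual_limit B (Suc m)))
      \<le> rate * N' (?y (Suc m) n - dual_limit B (Suc m))" for n
    by (simp only: nest.simps) (rule order_trans[OF backward.norm_le_N
      dual_step_contract[OF B nest_slice[OF B] dual_limit_slice[OF B]]])
  then have "(\<lambda>n. ?y m (Suc n) - dual_step (B m) (dual_limit B (Suc m))) \<longlonglongrightarrow> 0"
    by (intro Lim_null_comparison[OF _ rate_lim] always_eventually allI)
  then have "(\<lambda>n. ?y m (Suc n)) \<longlonglongrightarrow> dual_step (B m) (dual_limit B (Suc m))"
    by (rule LIM_zero_cancel)
  then show ?thesis
    by (rule LIMSEQ_unique[OF _ LIMSEQ_Suc[OF lim]])
qed

text \<open>The error bound \<open>rate ^ n * 2\<close> does not depend on \<open>x\<close>, and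
  each finite composition is continuous because its denominators do not vanish on the slice.\<close>

lemma continuous_on_dual_limit:
  assumes cont: "\<And>m. continuous_on S (\<lambda>x. B x m)" and near: "\<And>x m. x \<in> S \<Longrightarrow> near (B x m)"
  shows "continuous_on S (\<lambda>x. dual_limit (B x) m)"
proof (rule uniform_limit_theorem)
  let ?y = "\<lambda>x. nest (\<lambda>m. dual_step (B x m)) l"
  have "continuous_on S (\<lambda>x. ?y x m n)" for n m
  proof (induction n arbitrary: m)
    case (Suc n)
    have "bdot (?y x (Suc m) n) (B x m *v u) \<noteq> 0" if "x \<in> S" for x
      using that by (intro slice_pairing_nonzero near nest_slice)
    moreover have "?y x m (Suc n) = (1 / bdot (?y x (Suc m) n) (B x m *v u)) *s
        (transpose (B x m) *v ?y x (Suc m) n)" for x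
      by (simp only: nest.simps) (rule dual_step_def)
    ultimately show ?case
      by (simp only:) (intro continuous_intros Suc cont; blast)
  qed simp
  then show "\<forall>\<^sub>F n in sequentially. continuous_on S (\<lambda>x. ?y x m n)"
    by simp
  show "uniform_limit S (\<lambda>n x. ?y x m n) (\<lambda>x. dual_limit (B x) m) sequentially"
  proof (rule uniform_limitI)
    fix e :: real assume "0 < e"
    have "(\<lambda>n. rate ^ n * 2) \<longlonglongrightarrow> 0 * 2"
      by (intro tendsto_intros LIMSEQ_realpow_zero rate)
    then have "\<forall>\<^sub>F n in sequentially. rate ^ n * 2 < e"
      using \<open>0 < e\<close> by (intro order_tendstoD(2)) auto
    then show "\<forall>\<^sub>F n in sequentially. \<forall>x\<in>S. dist (?y x m n) (dual_limit (B x) m) < e"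
    proof eventually_elim
      case (elim n)
      then show ?case
        using nest_limit(2)[OF near] by (fastforce simp: dist_norm intro: le_less_trans)
    qed
  qed
qed simp

end

subsection \<open>Forward convergence\<close>

text \<open>Projective convergence lifted to vectors with free scalars, so that pairings with
  covectors can be used directly.\<close>

definition converges_in_direction :: "(nat \<Rightarrow> complex ^ 'k) \<Rightarrow> complex ^ 'k \<Rightarrow> bool"
  where "converges_in_direction v u \<longleftrightarrow>
    (\<exists>c. (\<forall>n. c n \<noteq> 0) \<and> (\<lambda>n. (1 / c n) *s v n) \<longlonglongrightarrow> u)"

context dominant_splitting
begin

definition pr :: "complex ^ 'k \<Rightarrow> complex ^ 'k"
  where "pr v = v - bdot l v *s u"

lemma bdot_pr: "bdot l (pr v) = 0"
  by (simp add: pr_def bdot_simps lu)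

lemma pr_add: "pr (v + w) = pr v + pr w"
  by (simp add: pr_def bdot_simps vec.scale_left_distrib)

lemma pr_scale: "pr (c *s v) = c *s pr v"
  by (simp add: pr_def bdot_simps vec.scale_right_diff_distrib)

lemma pr_split: "v = pr v + bdot l v *s u"
  by (simp add: pr_def)

lemma N_pr_le: "N (pr x) \<le> Cpr * norm x"
proof -
  have "N (pr x) \<le> N x + norm (bdot l x) * N u"
    using forward.N_diff[of x "bdot l x *s u"] by (simp only: pr_def forward.N_scale)
  also have "\<dots> \<le> C * norm x + (norm l * norm x) * (C * norm u)"
    by (intro add_mono mult_mono forward.N_le_norm norm_bdot_le forward.N_nonneg) auto
  finally show ?thesis by (simp add: Cpr_def algebra_simps)
qed

lemma pr_A: "pr (A *v v) = A *v pr v"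
proof -
  have "bdot l (A *v v) = lam * bdot l v"
    by (metis bdot_transpose A_l bdot_scale_left)
  then show ?thesis
    by (simp add: pr_def matrix_vector_mult_diff_distrib matrix_vector_scale A_u mult.commute)
qed

lemma N_pr_step: "N (pr (B *v v)) \<le> q * N (pr v) + Cpr * (norm (B - A) * norm v)"
proof -
  have "pr (B *v v) = A *v pr v + pr ((B - A) *v v)"
    by (subst matrix_diff_split[of B v A]) (simp only: pr_add pr_A)
  then have "N (pr (B *v v)) \<le> N (A *v pr v) + N (pr ((B - A) *v v))"
    by (simp only:) (rule forward.N_add)
  also have "\<dots> \<le> q * N (pr v) + Cpr * (norm (B - A) * norm v)"
    by (intro add_mono N_A bdot_pr order_trans[OF N_pr_le] mult_left_mono
        norm_matrix_vector_mult_le Cpr_nonneg)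
  finally show ?thesis .
qed

text \<open>The constant sequence \<open>B\<close> has a left eigenvector in the slice, so its largest eigenvalue is
  not much smaller than \<open>lam\<close>; hence an eigenvector for it has only a small component in
  the kernel of \<open>l\<close>.\<close>

lemma slice_eigenvector_pairing:
  assumes B: "near B" and v: "eigenvector B v mu"
    and max: "\<And>d. eigenvalue B d \<Longrightarrow> norm d \<le> norm mu"
  obtains c where "0 < c" "\<And>y. y \<in> slice \<Longrightarrow> c \<le> norm (bdot y v)"
proof -
  \<comment> \<open>For a constant sequence the limit covector is a fixed point of
    \<open>dual_step B\<close>, that is, a left eigenvector of \<open>B\<close>.\<close>
  define y0 where "y0 = dual_limit (\<lambda>_. B) 0"
  have "dual_limit (\<lambda>_. B) m = y0" for m
    unfolding y0_def dual_limit_def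
    by (rule arg_cong[where f = lim]) (rule ext, rule nest_constant)
  then have y0: "y0 \<in> slice" "dual_step B y0 = y0"
    using dual_limit_slice[of "\<lambda>_. B"] dual_limit_step[of "\<lambda>_. B" 0] B by simp_all
  define a where "a = bdot y0 (B *v u)"
  have "eigenvector (transpose B) y0 a"
    using y0 transpose_dual_step[OF B y0(1)]
    by (auto simp: eigenvector_def a_def slice_def)
  then have "norm a \<le> norm mu"
    using eigenvalue_transpose[of B a] by (intro max) (auto simp: eigenvalue_def)
  moreover have "norm lam - gap / 4 \<le> norm a"
    unfolding a_def by (rule slice_pairing_lower[OF B y0(1)])
  ultimately have mu: "norm lam - gap / 4 \<le> norm mu" by linarith
  define t where "t = bdot l v"
  define d where "d = norm (B - A)"
  have "norm v \<le> norm (pr v) + norm (t *s u)"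
    using norm_triangle_ineq[of "pr v" "t *s u"] pr_split[of v] by (simp only: t_def)
  also have "norm (pr v) \<le> N (pr v)"
    by (rule forward.norm_le_N)
  finally have norm_v: "norm v \<le> N (pr v) + norm t * norm u"
    by (simp add: norm_vector_scale)
  have "norm mu * N (pr v) = N (pr (B *v v))"
    using v by (simp only: eigenvector_def pr_scale forward.N_scale)
  also have "\<dots> \<le> q * N (pr v) + Cpr * (d * norm v)"
    unfolding d_def by (rule N_pr_step)
  also have "Cpr * (d * norm v) \<le> Cpr * (d * (N (pr v) + norm t * norm u))"
    using norm_v Cpr_nonneg by (intro mult_left_mono) (auto simp: d_def)
  also have "\<dots> = d * Cpr * N (pr v) + d * (Cpr * norm u) * norm t"
    by (simp add: algebra_simps)
  also have "d * Cpr * N (pr v) \<le> gap / 4 * N (pr v)"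
    using near_bounds(4)[OF B] by (intro mult_right_mono forward.N_nonneg) (simp add: d_def)
  also have "d * (Cpr * norm u) * norm t \<le> gap / 4 * norm t"
    using near_bounds(5)[OF B] by (intro mult_right_mono) (simp_all add: d_def)
  finally have "norm mu * N (pr v) \<le> q * N (pr v) + (gap / 4 * N (pr v) + gap / 4 * norm t)"
    by simp
  moreover have "(norm lam - gap / 4) * N (pr v) \<le> norm mu * N (pr v)"
    using mu by (intro mult_right_mono forward.N_nonneg)
  \<comment> \<open>As \<open>norm lam\<close> is \<open>q + gap\<close>, comparing with the upper
    bound leaves half of the gap as coefficient of \<open>N (pr v)\<close>.\<close>
  moreover have "(norm lam - gap / 4) * N (pr v) = (q + gap * 3 / 4) * N (pr v)"
    by (simp add: gap_def field_simps)
  ultimately have "gap / 2 * N (pr v) \<le> gap / 2 * (norm t / 2)"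
    by (simp add: algebra_simps)
  then have small: "N (pr v) \<le> norm t / 2"
    using gap_pos by (simp only: mult_le_cancel_left_pos half_gt_zero)
  have "t \<noteq> 0"
  proof
    assume "t = 0"
    then have "norm v \<le> 0" using norm_v small by (simp del: norm_le_zero_iff)
    then show False using v by (simp add: eigenvector_def)
  qed
  moreover have "norm t / 2 \<le> norm (bdot y v)" if y: "y \<in> slice" for y
  proof -
    have "bdot y v = bdot y (pr v + t *s u)" using pr_split[of v] by (simp only: t_def)
    also have "\<dots> = t + bdot (y - l) (pr v)"
      using y by (simp add: bdot_simps slice_def bdot_pr)
    finally have eq: "bdot y v = t + bdot (y - l) (pr v)" .
    have "norm (bdot (y - l) (pr v)) \<le> norm (y - l) * norm (pr v)"
      by (rule norm_bdot_le)
    also have "\<dots> \<le> 1 * N (pr v)"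
      using y backward.norm_le_N[of "y - l"] forward.norm_le_N[of "pr v"]
      by (intro mult_mono) (auto simp: slice_def)
    finally show ?thesis
      using small norm_triangle_ineq2[of t "- bdot (y - l) (pr v)"] eq by simp
  qed
  ultimately show thesis using that[of "norm t / 2"] by simp
qed

text \<open>The covectors \<open>W n\<close> will come from a different splitting, so they need not
  be close to \<open>l\<close>: boundedness and the normalisation against \<open>u\<close>
  suffice.\<close>

lemma forward_normalized:
  assumes B: "B \<longlonglongrightarrow> A"
    and Wu: "\<And>n. bdot (W n) u = 1" and W_norm: "\<And>n. norm (W n) \<le> L"
    and W_step: "\<And>n. transpose (B n) *v W (Suc n) = g n *s W n" and g: "\<And>n. g n \<noteq> 0"
    and v_step: "\<And>n. v (Suc n) = B n *v v n"
  shows "converges_in_direction v u \<longleftrightarrow> bdot (W 0) (v 0) \<noteq> 0"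
proof -
  have L: "0 \<le> L" using W_norm[of 0] norm_ge_zero order_trans by blast
  define al where "al n = bdot (W n) (v n)" for n
  have al_Suc: "al (Suc n) = g n * al n" for n
    by (simp add: al_def v_step bdot_transpose[symmetric] W_step bdot_scale_left)
  show ?thesis
  proof
    assume "converges_in_direction v u"
    then obtain c where c: "\<And>n. c n \<noteq> 0" "(\<lambda>n. (1 / c n) *s v n) \<longlonglongrightarrow> u"
      by (auto simp: converges_in_direction_def)
    show "bdot (W 0) (v 0) \<noteq> 0"
    proof
      assume "bdot (W 0) (v 0) = 0"
      then have al0: "al n = 0" for n
        by (induction n) (simp_all add: al_Suc, simp add: al_def)
      \<comment> \<open>\<open>W n\<close> annihilates \<open>v n\<close> but pairs to 1 with
        \<open>u\<close>, which keeps the rescaled \<open>v n\<close> away from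
        \<open>u\<close>.\<close>
      have "1 \<le> L * norm ((1 / c n) *s v n - u)" for n
      proof -
        have "norm (bdot (W n) ((1 / c n) *s v n - u)) = 1"
          using al0[of n] by (simp add: bdot_diff_right bdot_scale_right Wu al_def)
        then have "1 \<le> norm (W n) * norm ((1 / c n) *s v n - u)"
          using norm_bdot_le by metis
        also have "\<dots> \<le> L * norm ((1 / c n) *s v n - u)"
          by (intro mult_right_mono W_norm) auto
        finally show ?thesis .
      qed
      moreover have "(\<lambda>n. L * norm ((1 / c n) *s v n - u)) \<longlonglongrightarrow> 0"
        using tendsto_mult_right_zero[OF tendsto_norm_zero[OF LIM_zero[OF c(2)]]] .
      ultimately have "(1::real) \<le> 0"
        by (intro tendsto_lowerbound[of _ 0 sequentially 1]) auto
      then show False by simp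
    qed
  next
    assume "bdot (W 0) (v 0) \<noteq> 0"
    then have al: "al n \<noteq> 0" for n
      by (induction n) (simp_all add: al_Suc g, simp add: al_def)
    define e where "e n = norm (B n - A)" for n
    have e: "e \<longlonglongrightarrow> 0" unfolding e_def
      by (rule tendsto_norm_zero[OF LIM_zero[OF B]])
    \<comment> \<open>The component in the kernel of \<open>l\<close> relative to the scalar
      \<open>al n\<close>. Dividing by \<open>al n\<close> rather than by
      \<open>bdot l (v n)\<close> gives an exact multiplicative recurrence for the
      denominator.\<close>
    define rho where "rho n = N (pr (v n)) / norm (al n)" for n
    define d where "d n = Cpr * e n * norm u / (norm lam - gap / 4)" for n
    have Wpr: "al n = bdot l (v n) + bdot (W n) (pr (v n))" for n
      by (simp add: al_def pr_def bdot_diff_right bdot_scale_right Wu)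
    have Wpr_le: "norm (bdot (W n) (pr (v n))) \<le> L * N (pr (v n))" for n
      by (rule order_trans[OF norm_bdot_le])
        (intro mult_mono W_norm forward.norm_le_N L norm_ge_zero)
    have norm_v: "norm (v n) \<le> norm (al n) * norm u + (L * norm u + 1) * N (pr (v n))" for n
    proof -
      have "norm (v n) \<le> norm (pr (v n)) + norm (bdot l (v n)) * norm u"
        using norm_triangle_ineq[of "pr (v n)" "bdot l (v n) *s u"] pr_split[of "v n"]
        by (simp only: norm_vector_scale)
      also have "\<dots> \<le> N (pr (v n)) + (norm (al n) + L * N (pr (v n))) * norm u"
      proof (intro add_mono forward.norm_le_N mult_right_mono norm_ge_zero)
        have "bdot l (v n) = al n - bdot (W n) (pr (v n))" using Wpr[of n] by simp
        then show "norm (bdot l (v n)) \<le> norm (al n) + L * N (pr (v n))"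
          using norm_triangle_ineq4[of "al n" "bdot (W n) (pr (v n))"] Wpr_le[of n] by simp
      qed
      finally show ?thesis by (simp add: algebra_simps)
    qed
    \<comment> \<open>The first limit keeps the growth factor of \<open>N (pr (v n))\<close> below
      \<open>q + gap / 4\<close>, the second keeps \<open>norm (g n)\<close> above
      \<open>norm lam - gap / 4\<close>; the quotient is \<open>rate\<close>.\<close>
    have lim1: "(\<lambda>n. e n * (Cpr * (L * norm u + 1))) \<longlonglongrightarrow> 0"
      and lim2: "(\<lambda>n. e n * (L * norm u)) \<longlonglongrightarrow> 0"
      using tendsto_mult_left_zero[OF e] by auto
    have "\<forall>\<^sub>F n in sequentially. e n * (Cpr * (L * norm u + 1)) < gap / 4 \<and> e n * (L * norm u) < gap / 4"
      using order_tendstoD(2)[OF lim1, of "gap / 4"] order_tendstoD(2)[OF lim2, of "gap / 4"] gap_pos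
      by (intro eventually_conj) auto
    then have rec: "\<forall>\<^sub>F n in sequentially. rho (Suc n) \<le> rate * rho n + d n"
    proof eventually_elim
      case (elim n)
      have "g n = bdot (W (Suc n)) (B n *v u)"
        using bdot_transpose[of "B n" "W (Suc n)" u] by (simp add: W_step bdot_scale_left Wu)
      then have "g n = lam - - bdot (W (Suc n)) ((B n - A) *v u)"
        by (simp add: slice_pairing[of _ "B n"] Wu)
      moreover have "norm (bdot (W (Suc n)) ((B n - A) *v u)) \<le> L * (e n * norm u)"
        unfolding e_def by (rule order_trans[OF norm_pairing_le]) (intro mult_right_mono W_norm; simp)
      ultimately have g_lower: "norm lam - gap / 4 \<le> norm (g n)"
        using norm_triangle_ineq2[of lam "- bdot (W (Suc n)) ((B n - A) *v u)"] elim
        by (simp add: mult_ac)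
      then have g_pos: "0 < norm (g n)" using lower_pos by linarith
      have "N (pr (v (Suc n))) \<le> q * N (pr (v n)) + Cpr * (e n * norm (v n))"
        unfolding v_step e_def by (rule N_pr_step)
      also have "Cpr * (e n * norm (v n)) \<le>
          Cpr * (e n * (norm (al n) * norm u + (L * norm u + 1) * N (pr (v n))))"
        by (intro mult_left_mono norm_v Cpr_nonneg) (simp add: e_def)
      also have "\<dots> = e n * (Cpr * (L * norm u + 1)) * N (pr (v n)) + Cpr * e n * norm u * norm (al n)"
        by (simp add: algebra_simps)
      also have "e n * (Cpr * (L * norm u + 1)) * N (pr (v n)) \<le> gap / 4 * N (pr (v n))"
        using elim by (intro mult_right_mono forward.N_nonneg) auto
      finally have "N (pr (v (Suc n))) \<le> (q + gap / 4) * N (pr (v n)) + Cpr * e n * norm u * norm (al n)"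
        by (simp add: algebra_simps)
      then have "rho (Suc n) \<le>
          ((q + gap / 4) * N (pr (v n)) + Cpr * e n * norm u * norm (al n)) / (norm (g n) * norm (al n))"
        unfolding rho_def al_Suc norm_mult by (intro divide_right_mono) auto
      also have "\<dots> = ((q + gap / 4) * rho n + Cpr * e n * norm u) / norm (g n)"
        using al[of n] g_pos by (simp add: rho_def field_simps)
      also have "\<dots> \<le> ((q + gap / 4) * rho n + Cpr * e n * norm u) / (norm lam - gap / 4)"
        using g_lower lower_pos q gap_pos Cpr_nonneg g_pos forward.N_nonneg
        by (intro divide_left_mono add_nonneg_nonneg mult_nonneg_nonneg mult_pos_pos)
          (auto simp: rho_def e_def)
      finally show ?case
        by (simp only: rate_def d_def add_divide_distrib[symmetric] times_divide_eq_left)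
    qed
    have "d \<longlonglongrightarrow> Cpr * 0 * norm u / (norm lam - gap / 4)"
      unfolding d_def using lower_pos by (intro tendsto_intros e) auto
    then have "d \<longlonglongrightarrow> 0" by simp
    moreover have "0 \<le> rho n" for n by (simp add: rho_def forward.N_nonneg)
    ultimately have rho: "rho \<longlonglongrightarrow> 0"
      using contracting_recurrence_tendsto_zero[OF rate, of rho d] rec by blast
    have bound: "norm ((1 / al n) *s v n - u) \<le> rho n * (1 + L * norm u)" for n
    proof -
      have "(1 / al n) *s v n - u = (1 / al n) *s (v n - al n *s u)"
        using al[of n] by (simp add: vec.scale_right_diff_distrib)
      also have "v n - al n *s u = pr (v n) - bdot (W n) (pr (v n)) *s u"
        by (simp add: Wpr[of n] vec.scale_left_distrib) (simp add: pr_def)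
      finally have "norm ((1 / al n) *s v n - u)
          = norm (pr (v n) - bdot (W n) (pr (v n)) *s u) / norm (al n)"
        by (simp only: norm_vector_scale) (simp add: norm_divide)
      also have "\<dots> \<le> (N (pr (v n)) + L * N (pr (v n)) * norm u) / norm (al n)"
      proof (intro divide_right_mono norm_ge_zero order_trans[OF norm_triangle_ineq4] add_mono forward.norm_le_N)
        show "norm (bdot (W n) (pr (v n)) *s u) \<le> L * N (pr (v n)) * norm u"
          unfolding norm_vector_scale by (intro mult_right_mono Wpr_le norm_ge_zero)
      qed
      also have "\<dots> = rho n * (1 + L * norm u)"
        by (simp add: rho_def field_simps)
      finally show ?thesis .
    qed
    have "(\<lambda>n. rho n * (1 + L * norm u)) \<longlonglongrightarrow> 0"
      by (rule tendsto_mult_left_zero[OF rho])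
    then have "(\<lambda>n. (1 / al n) *s v n - u) \<longlonglongrightarrow> 0"
      by (rule Lim_null_comparison[rotated]) (rule always_eventually, rule allI, rule bound)
    then have "(\<lambda>n. (1 / al n) *s v n) \<longlonglongrightarrow> u" by (rule LIM_zero_cancel)
    then show "converges_in_direction v u"
      using al unfolding converges_in_direction_def by blast
  qed
qed

text \<open>Rescaling each \<open>W n\<close> to pair to 1 with \<open>u\<close> only changes the
  multipliers to \<open>g n * h n / h (Suc n)\<close>; the uniform lower bound \<open>c\<close>
  keeps the rescaled covectors bounded.\<close>

lemma forward_direction:
  assumes B: "B \<longlonglongrightarrow> A"
    and c: "0 < c" "\<And>n. c \<le> norm (bdot (W n) u)" and W_norm: "\<And>n. norm (W n) \<le> L"
    and W_step: "\<And>n. transpose (B n) *v W (Suc n) = g n *s W n" and g: "\<And>n. g n \<noteq> 0"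
    and v_step: "\<And>n. v (Suc n) = B n *v v n"
  shows "converges_in_direction v u \<longleftrightarrow> bdot (W 0) (v 0) \<noteq> 0"
proof -
  define h where "h n = bdot (W n) u" for n
  have h: "h n \<noteq> 0" for n using c(1) c(2)[of n] by (auto simp: h_def)
  define V where "V n = (1 / h n) *s W n" for n
  have "converges_in_direction v u \<longleftrightarrow> bdot (V 0) (v 0) \<noteq> 0"
  proof (rule forward_normalized[OF B _ _ _ _ v_step])
    show "bdot (V n) u = 1" for n using h[of n] by (simp add: V_def bdot_scale_left h_def)
    show "norm (V n) \<le> L / c" for n
      using c(1) c(2)[of n] W_norm[of n] order_trans[OF norm_ge_zero W_norm[of n]]
      unfolding V_def norm_vector_scale norm_divide h_def
      by (simp, intro frac_le) auto
    show "transpose (B n) *v V (Suc n) = (g n * h n / h (Suc n)) *s V n" for n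
      using h[of n] by (simp add: V_def matrix_vector_scale W_step)
    show "g n * h n / h (Suc n) \<noteq> 0" for n using g h by simp
  qed
  then show ?thesis using h[of 0] by (simp add: V_def bdot_scale_left)
qed

end

subsection \<open>Convergence in projective space\<close>

lemma proj_class_eq_imp_scale:
  assumes "v \<noteq> 0" "w \<noteq> 0" "proj_class v = proj_class w"
  obtains c where "c \<noteq> 0" "v = c *s w"
proof -
  have "vec.span {v} = vec.span {w}"
    using assms Rep_proj_class by metis
  then have "v \<in> vec.span {w}"
    using vec.span_base by blast
  then obtain c where "v = c *s w" by (auto simp: vec.span_singleton)
  with assms(1) that show thesis by auto
qed

lemma tendsto_proj_class:
  fixes a :: "complex ^ 'k"
  assumes "(f \<longlongrightarrow> a) F" "a \<noteq> 0"
  shows "((\<lambda>x. proj_class (f x)) \<longlongrightarrow> proj_class a) F"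
proof (rule topological_tendstoI)
  fix S :: "'k proj set" assume "open S" "proj_class a \<in> S"
  then have "\<forall>\<^sub>F x in F. f x \<in> {v. v \<noteq> 0 \<and> proj_class v \<in> S}"
    using assms by (intro topological_tendstoD) (auto simp: open_proj_def)
  then show "\<forall>\<^sub>F x in F. proj_class (f x) \<in> S"
    by eventually_elim simp
qed

text \<open>Testing \<open>w'\<close> on the vectors of the hyperplane supported on two coordinates
  shows that all 2 by 2 minors of the pair \<open>w\<close>, \<open>w'\<close> vanish.\<close>

lemma hyperplane_eq_imp_proj_class_eq:
  assumes "w \<noteq> 0" "w' \<noteq> 0" "hyperplane w = hyperplane w'"
  shows "proj_class w = proj_class w'"
proof -
  obtain i where i: "w $ i \<noteq> 0" using assms(1) by (auto simp: vec_eq_iff)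
  define c where "c = w' $ i / w $ i"
  have "w' $ j = c * w $ j" for j
  proof -
    have "w $ j *s axis i 1 - w $ i *s axis j 1 \<in> hyperplane w"
      by (simp add: hyperplane_eq bdot_diff_right bdot_scale_right)
    then have "w $ j *s axis i 1 - w $ i *s axis j 1 \<in> hyperplane w'"
      using assms(3) by simp
    then show ?thesis
      using i by (simp add: c_def hyperplane_eq bdot_diff_right bdot_scale_right field_simps)
  qed
  then have w': "w' = c *s w" by (simp add: vec_eq_iff)
  with assms(2) have "c \<noteq> 0" by auto
  with w' show ?thesis by (metis proj_class_scale)
qed

lemma converges_in_direction_proj_class:
  assumes "converges_in_direction v u" "u \<noteq> 0"
  shows "(\<lambda>n. proj_class (v n)) \<longlonglongrightarrow> proj_class u"
proof -
  obtain c where c: "\<And>n. c n \<noteq> 0" "(\<lambda>n. (1 / c n) *s v n) \<longlonglongrightarrow> u"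
    using assms(1) by (auto simp: converges_in_direction_def)
  have "proj_class ((1 / c n) *s v n) = proj_class (v n)" for n
    using c(1)[of n] by (intro proj_class_scale) simp
  then show ?thesis
    using tendsto_proj_class[OF c(2) assms(2)] by simp
qed

lemma converges_in_direction_shift:
  "converges_in_direction (\<lambda>n. v (k + n)) u \<longleftrightarrow> converges_in_direction v u"
proof
  assume "converges_in_direction (\<lambda>n. v (k + n)) u"
  then obtain c where c: "\<And>n. c n \<noteq> 0" "(\<lambda>n. (1 / c n) *s v (k + n)) \<longlonglongrightarrow> u"
    by (auto simp: converges_in_direction_def)
  \<comment> \<open>The first \<open>k\<close> scalars are arbitrary, but the definition requires
    them to be nonzero.\<close>
  define c' where "c' n = (if n < k then 1 else c (n - k))" for n
  have "(\<lambda>n. (1 / c' (n + k)) *s v (n + k)) \<longlonglongrightarrow> u"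
    using c(2) by (simp add: c'_def add.commute)
  then have "(\<lambda>n. (1 / c' n) *s v n) \<longlonglongrightarrow> u"
    by (rule LIMSEQ_offset)
  moreover have "c' n \<noteq> 0" for n using c(1) by (simp add: c'_def)
  ultimately show "converges_in_direction v u"
    unfolding converges_in_direction_def by blast
next
  assume "converges_in_direction v u"
  then obtain c where c: "\<And>n. c n \<noteq> 0" "(\<lambda>n. (1 / c n) *s v n) \<longlonglongrightarrow> u"
    by (auto simp: converges_in_direction_def)
  have lim: "(\<lambda>n. (1 / c (k + n)) *s v (k + n)) \<longlonglongrightarrow> u"
    using LIMSEQ_ignore_initial_segment[OF c(2), of k] by (simp add: add.commute)
  show "converges_in_direction (\<lambda>n. v (k + n)) u"
    unfolding converges_in_direction_def
    by (rule exI[of _ "\<lambda>n. c (k + n)"]) (simp only: c(1) lim not_False_eq_True simp_thms)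
qed

section \<open>Local construction of the covector field and gluing\<close>

lemma invertible_mat_prod:
  assumes "\<And>n. n \<ge> 1 \<Longrightarrow> invertible (T n)"
  shows "invertible (mat_prod T n)"
proof (induction n)
  case 0
  show ?case by (auto simp: invertible_def intro!: exI[of _ "mat 1"])
qed (simp add: invertible_mult assms)

lemma continuous_on_mat_prod:
  assumes "\<And>n. n \<ge> 1 \<Longrightarrow> continuous_on S (T n)"
  shows "continuous_on S (\<lambda>x. mat_prod (\<lambda>m. T m x) n)"
proof (induction n)
  case (Suc n)
  then show ?case using assms[of "Suc n"] by (simp add: continuous_on_matrix_mult)
qed simp

text \<open>The index \<open>M\<close> beyond which all factors are \<open>near\<close> must serve
  every \<open>x\<close> of the ball at once; it comes from uniform convergence on a compact ball,
  which also makes \<open>Tlim\<close> continuous there.\<close>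

lemma local_dual_direction:
  fixes D :: "(real ^ 'd) set"
    and T :: "nat \<Rightarrow> real ^ 'd \<Rightarrow> complex ^ 'k ^ 'k"
    and Tlim :: "real ^ 'd \<Rightarrow> complex ^ 'k ^ 'k"
    and lam_max :: "real ^ 'd \<Rightarrow> complex"
    and u_max :: "real ^ 'd \<Rightarrow> complex ^ 'k"
  assumes D: "open D"
    and inv: "\<And>n x. n \<ge> 1 \<Longrightarrow> x \<in> D \<Longrightarrow> invertible (T n x)"
    and cont: "\<And>n. n \<ge> 1 \<Longrightarrow> continuous_on D (T n)"
    and unif: "\<And>K. compact K \<Longrightarrow> K \<subseteq> D \<Longrightarrow> uniform_limit K T Tlim sequentially"
    and dom: "\<And>x. x \<in> D \<Longrightarrow> {c. max_modulus_eigenvalue (Tlim x) c} = {lam_max x}"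
    and simple: "\<And>x. x \<in> D \<Longrightarrow> simple_eigenvalue (Tlim x) (lam_max x)"
    and u: "\<And>x. x \<in> D \<Longrightarrow> eigenvector (Tlim x) (u_max x) (lam_max x)"
    and nontriv: "p \<noteq> (p' :: 'k proj)" and x0: "x0 \<in> D"
  shows "\<exists>r W. 0 < r \<and> ball x0 r \<subseteq> D \<and> continuous_on (ball x0 r) W \<and>
    (\<forall>x\<in>ball x0 r. W x \<noteq> 0 \<and> hyperplane (W x) =
      {v. \<not> converges_in_direction (\<lambda>n. mat_prod (\<lambda>m. T m x) n *v v) (u_max x)})"
proof -
  have lam: "lam_max x \<noteq> 0" if "x \<in> D" for x
    using dominant_eigenvalue_nonzero[OF dom simple u nontriv] that by blast
  obtain N0 N0' C0 l0 q0 where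
    "dominant_splitting N0 N0' C0 (Tlim x0) (lam_max x0) (u_max x0) l0 q0"
    using dominant_splitting_exists[OF dom simple u lam] x0 by blast
  then interpret s0: dominant_splitting N0 N0' C0 "Tlim x0" "lam_max x0" "u_max x0" l0 q0 .
  obtain e where e: "0 < e" "\<And>B. norm (B - Tlim x0) \<le> e \<Longrightarrow> s0.near B"
    using s0.near_exists by blast
  obtain r0 where r0: "0 < r0" "cball x0 r0 \<subseteq> D"
    using open_contains_cball[of D] D x0 by blast
  have unif0: "uniform_limit (cball x0 r0) T Tlim sequentially"
    by (intro unif r0 compact_cball)
  have "\<forall>\<^sub>F n in sequentially. continuous_on (cball x0 r0) (T n)"
    using cont continuous_on_subset r0(2) unfolding eventually_sequentially by blast
  then have "continuous_on (cball x0 r0) Tlim"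
    by (rule uniform_limit_theorem[OF _ unif0]) simp
  then obtain r1 where r1: "0 < r1"
      "\<And>x. x \<in> cball x0 r0 \<Longrightarrow> dist x x0 < r1 \<Longrightarrow> dist (Tlim x) (Tlim x0) < e / 2"
    using e(1) r0(1) unfolding continuous_on_iff by (metis centre_in_cball half_gt_zero less_imp_le)
  define r where "r = min r0 r1"
  have r: "0 < r" "ball x0 r \<subseteq> cball x0 r0"
    using r0(1) r1(1) by (auto simp: r_def)
  have "\<forall>\<^sub>F n in sequentially. \<forall>x\<in>cball x0 r0. dist (T n x) (Tlim x) < e / 2"
    using e(1) by (intro uniform_limitD[OF unif0]) simp
  then obtain M where M: "\<forall>n\<ge>M. \<forall>x\<in>cball x0 r0. dist (T n x) (Tlim x) < e / 2"
    unfolding eventually_sequentially by blast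
  have lim_close: "dist (Tlim x) (Tlim x0) < e / 2" if "x \<in> ball x0 r" for x
    using that r by (intro r1) (auto simp: r_def dist_commute)
  have near_lim: "s0.near (Tlim x)" if "x \<in> ball x0 r" for x
    using lim_close[OF that] e(1) by (intro e) (simp add: dist_norm)
  \<comment> \<open>\<open>mat_prod\<close> starts with \<open>T 1\<close>, so the first factor
    after a product of length \<open>M\<close> is \<open>T (Suc M)\<close>.\<close>
  define B where "B x m = T (Suc (M + m)) x" for x m
  have near: "s0.near (B x m)" if x: "x \<in> ball x0 r" for x m
  proof -
    have "dist (B x m) (Tlim x) < e / 2"
      unfolding B_def using x r(2) by (intro M[rule_format]) auto
    with lim_close[OF x] show ?thesis
      by (intro e) (metis add.commute dist_norm dist_triangle_half_l dist_commute less_imp_le)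
  qed
  have ball_D: "ball x0 r \<subseteq> D" using r(2) r0(2) by blast
  define W where "W x = transpose (mat_prod (\<lambda>m. T m x) M) *v s0.dual_limit (B x) 0" for x
  show ?thesis
  proof (intro exI[of _ r] exI[of _ W] conjI ballI r(1) ball_D)
    have cont': "continuous_on (ball x0 r) (T n)" if "n \<ge> 1" for n
      using cont[OF that] ball_D continuous_on_subset by blast
    then have "continuous_on (ball x0 r) (\<lambda>x. s0.dual_limit (B x) 0)"
      by (intro s0.continuous_on_dual_limit near) (auto simp: B_def)
    then show "continuous_on (ball x0 r) W"
      unfolding W_def by (intro continuous_intros continuous_on_mat_prod cont')
  next
    fix x assume x: "x \<in> ball x0 r"
    then have xD: "x \<in> D" using ball_D by blast
    define P where "P = mat_prod (\<lambda>m. T m x)"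
    define w where "w = s0.dual_limit (B x)"
    have w: "w m \<in> s0.slice" for m
      unfolding w_def by (intro s0.dual_limit_slice near x)
    have "invertible (transpose (P M))"
      using invertible_mat_prod[of "\<lambda>m. T m x" M] inv xD by (simp add: P_def invertible_det_nz)
    moreover have "w 0 \<noteq> 0" using w[of 0] by (auto simp: s0.slice_def)
    ultimately show "W x \<noteq> 0"
      unfolding W_def P_def[symmetric] w_def[symmetric]
      using matrix_left_invertible_ker[of "transpose (P M)"] by (auto simp: invertible_left_inverse)
    \<comment> \<open>The second splitting, at \<open>x\<close> itself: it needs no relation to the
      one at \<open>x0\<close> beyond the pairing bound obtained next.\<close>
    obtain N N' C l q where "dominant_splitting N N' C (Tlim x) (lam_max x) (u_max x) l q"
      using dominant_splitting_exists[OF dom simple u lam] xD by blast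
    then interpret s: dominant_splitting N N' C "Tlim x" "lam_max x" "u_max x" l q .
    have "max_modulus_eigenvalue (Tlim x) (lam_max x)" using dom[OF xD] by blast
    then obtain c where c: "0 < c" "\<And>y. y \<in> s0.slice \<Longrightarrow> c \<le> norm (bdot y (u_max x))"
      using s0.slice_eigenvector_pairing[OF near_lim[OF x] u[OF xD]]
      unfolding max_modulus_eigenvalue_def by metis
    have B_lim: "B x \<longlonglongrightarrow> Tlim x"
    proof -
      have "(\<lambda>n. T n x) \<longlonglongrightarrow> Tlim x"
        using tendsto_uniform_limitI[OF unif0] x r(2) by blast
      then show ?thesis
        using LIMSEQ_ignore_initial_segment[of "\<lambda>n. T n x" _ "Suc M"] by (simp add: B_def[abs_def] add.commute)
    qed
    have "converges_in_direction (\<lambda>n. P n *v v) (u_max x) \<longleftrightarrow> bdot (W x) v \<noteq> 0" for v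
    proof -
      have "converges_in_direction (\<lambda>n. P (M + n) *v v) (u_max x) \<longleftrightarrow> bdot (w 0) (P (M + 0) *v v) \<noteq> 0"
      proof (rule s.forward_direction[OF B_lim c(1)])
        show "c \<le> norm (bdot (w n) (u_max x))" for n by (intro c w)
        show "norm (w n) \<le> norm l0 + 1" for n by (intro s0.slice_norm w)
        \<comment> \<open>The multiplier involves \<open>u_max x0\<close>, since the covectors are
          normalised in the chart at \<open>x0\<close>, although the surrounding argument takes
          place in the splitting at \<open>x\<close>.\<close>
        show "transpose (B x n) *v w (Suc n) = bdot (w (Suc n)) (B x n *v u_max x0) *s w n" for n
          using s0.transpose_dual_step[OF near[OF x] w, of n "Suc n"]
            s0.dual_limit_step[of "B x" n] near[OF x] by (simp add: w_def)
        show "bdot (w (Suc n)) (B x n *v u_max x0) \<noteq> 0" for n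
          by (intro s0.slice_pairing_nonzero near x w)
        show "P (M + Suc n) *v v = B x n *v (P (M + n) *v v)" for n
          by (simp add: P_def B_def matrix_vector_mul_assoc)
      qed
      then show ?thesis
        unfolding converges_in_direction_shift[of "\<lambda>n. P n *v v"]
        by (simp add: W_def P_def[symmetric] w_def bdot_transpose)
    qed
    then show "hyperplane (W x) =
        {v. \<not> converges_in_direction (\<lambda>n. mat_prod (\<lambda>m. T m x) n *v v) (u_max x)}"
      by (simp add: hyperplane_eq P_def)
  qed
qed

theorem theorem5:
  fixes D :: "(real ^ 'd) set"
    and T :: "nat \<Rightarrow> real ^ 'd \<Rightarrow> complex ^ 'k ^ 'k"
    and Tlim :: "real ^ 'd \<Rightarrow> complex ^ 'k ^ 'k"
    and lam_max :: "real ^ 'd \<Rightarrow> complex"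
    and u_max :: "real ^ 'd \<Rightarrow> complex ^ 'k"
  assumes "open D" and "connected D" and "D \<noteq> {}"
    and "\<And>n x. n \<ge> 1 \<Longrightarrow> x \<in> D \<Longrightarrow> invertible (T n x)"
    and "\<And>n. n \<ge> 1 \<Longrightarrow> continuous_on D (T n)"
    and "\<And>K. compact K \<Longrightarrow> K \<subseteq> D \<Longrightarrow> uniform_limit K T Tlim sequentially"
    and "\<And>x. x \<in> D \<Longrightarrow> {c. max_modulus_eigenvalue (Tlim x) c} = {lam_max x}"
    and "\<And>x. x \<in> D \<Longrightarrow> simple_eigenvalue (Tlim x) (lam_max x)"
    and "\<And>x. x \<in> D \<Longrightarrow> eigenvector (Tlim x) (u_max x) (lam_max x)"
  shows "\<exists>w_hat :: real ^ 'd \<Rightarrow> 'k proj.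
    continuous_on D w_hat \<and>
    (\<forall>x\<in>D. \<forall>w. w \<noteq> 0 \<and> proj_class w = w_hat x \<longrightarrow>
      (\<forall>p. p \<notin> proj_subset (hyperplane w) \<longrightarrow>
        (\<lambda>n. proj_map (mat_prod (\<lambda>m. T m x) n) p)
          \<longlonglongrightarrow> proj_map (rank_one (u_max x) w) p))"
proof (cases "\<forall>p p' :: 'k proj. p = p'")
  case True \<comment> \<open>That is, \<open>k = 1\<close>: the only case in which \<open>lam_max x = 0\<close> is possible.\<close>
  then have "p = p'" for p p' :: "'k proj" by blast
  then have "f = (\<lambda>_. p)" for f :: "nat \<Rightarrow> 'k proj" and p
    by blast
  then have "f \<longlonglongrightarrow> p" for f and p :: "'k proj"
    by (metis tendsto_const)
  then show ?thesis
    by (intro exI[of _ "\<lambda>_. undefined"] conjI continuous_on_const) blast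
next
  case False
  then obtain p p' :: "'k proj" where nontriv: "p \<noteq> p'" by blast
  define H where "H x = {v. \<not> converges_in_direction (\<lambda>n. mat_prod (\<lambda>m. T m x) n *v v) (u_max x)}" for x
  \<comment> \<open>A hyperplane determines its covector up to scaling, so the class is independent
    of the choice; hence \<open>w_hat\<close> is locally the class of the continuous field
    \<open>W\<close>, although the chosen covectors may jump.\<close>
  define w_hat where "w_hat x = proj_class (SOME w. w \<noteq> 0 \<and> hyperplane w = H x)" for x
  have w_hat_eq: "w_hat x = proj_class w" if "w \<noteq> 0" "hyperplane w = H x" for x w
    unfolding w_hat_def
    by (rule hyperplane_eq_imp_proj_class_eq) (use someI[of "\<lambda>w. w \<noteq> 0 \<and> hyperplane w = H x" w] that in auto)
  have local: "\<exists>r W. 0 < r \<and> ball x r \<subseteq> D \<and> continuous_on (ball x r) W \<and>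
      (\<forall>y\<in>ball x r. W y \<noteq> 0 \<and> hyperplane (W y) = H y)" if "x \<in> D" for x
    unfolding H_def by (rule local_dual_direction[OF assms(1,4-9) nontriv that])
  have "continuous_on D w_hat"
  proof (rule continuous_at_imp_continuous_on, rule ballI)
    fix x assume "x \<in> D"
    then obtain r W where W: "0 < r" "continuous_on (ball x r) W"
        "\<And>y. y \<in> ball x r \<Longrightarrow> W y \<noteq> 0 \<and> hyperplane (W y) = H y"
      using local by metis
    have "(W \<longlongrightarrow> W x) (at x)"
      using W(1,2) by (simp add: continuous_on_eq_continuous_at isCont_def)
    then have "((\<lambda>y. proj_class (W y)) \<longlongrightarrow> proj_class (W x)) (at x)"
      using W(1) W(3)[of x] by (intro tendsto_proj_class) auto
    moreover have W_eq: "proj_class (W y) = w_hat y" if "y \<in> ball x r" for y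
      using W(3)[OF that] by (intro w_hat_eq[symmetric]) auto
    then have "\<forall>\<^sub>F y in at x. proj_class (W y) = w_hat y"
      unfolding eventually_at_topological using W(1) by (intro exI[of _ "ball x r"]) auto
    ultimately have "(w_hat \<longlongrightarrow> proj_class (W x)) (at x)"
      by (rule Lim_transform_eventually)
    then show "isCont w_hat x"
      using W(1) by (simp add: isCont_def W_eq)
  qed
  moreover have "(\<lambda>n. proj_map (mat_prod (\<lambda>m. T m x) n) p) \<longlonglongrightarrow> proj_map (rank_one (u_max x) w) p"
    if x: "x \<in> D" and w: "w \<noteq> 0" "proj_class w = w_hat x" and p: "p \<notin> proj_subset (hyperplane w)"
    for x w p
  proof -
    \<comment> \<open>The given representative \<open>w\<close> is a multiple of a covector known to
      define \<open>H x\<close>, so both have the same kernel.\<close>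
    obtain w0 where w0: "w0 \<noteq> 0" "hyperplane w0 = H x"
      using local[OF x] by (meson centre_in_ball)
    then obtain c where c: "c \<noteq> 0" "w = c *s w0"
      using w w_hat_eq by (metis proj_class_eq_imp_scale)
    then have Hw: "hyperplane w = H x"
      unfolding w0(2)[symmetric] by (simp add: hyperplane_eq bdot_scale_left)
    obtain v where v: "v \<noteq> 0" "p = proj_class v" using proj_class_surj by blast
    with p have "v \<notin> H x" unfolding Hw[symmetric] proj_subset_def by blast
    then have "converges_in_direction (\<lambda>n. mat_prod (\<lambda>m. T m x) n *v v) (u_max x)"
      by (simp add: H_def)
    moreover have "u_max x \<noteq> 0" using assms(9)[OF x] by (simp add: eigenvector_def)
    ultimately show ?thesis
      unfolding proj_map_rank_one[OF p] unfolding v(2) proj_map_class[OF v(1)]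
      by (rule converges_in_direction_proj_class)
  qed
  ultimately show ?thesis by blast
qed

end
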